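(* Let $K\ge1$ be fixed, let $\boldsymbol{\beta}_0\in\mathbb{R}^K$, and for each $n$ let $\mathbf{x}_1,\dots,\mathbf{x}_n\in\mathbb{R}^K$ (rows of the $n\times K$ design matrix $\mathbf{X}$) satisfy: (i) $\sum_{i=1}^n x_{i,k}=0$ and $\sum_{i=1}^n x_{i,k}^2=n$ for each $k$; (ii) $\max_{1\le i\le n}\|\mathbf{x}_i\|/\sqrt n\to0$; (iii) $\mathbf{X}^t\mathbf{X}$ is positive definite; (iv) $\mathbf{X}^t\mathbf{X}/n\to\boldsymbol{\Sigma}_0$ with $\boldsymbol{\Sigma}_0$ positive definite. Suppose $Y_{ni}=\mathbf{x}_i^t\boldsymbol{\beta}_0/\sqrt n+\varepsilon_{ni}$, $i=1,\dots,n$, where for each $n$ the $\varepsilon_{n1},\dots,\varepsilon_{nn}$ are independent with $\mathbb{E}(\varepsilon_{ni})=0$, $\mathbb{E}(\varepsilon_{ni}^2)=1$ and $\mathbb{E}(\varepsilon_{ni}^4)\le M$ for some $M<\infty$. Let $Y_{ni}^*=\sqrt n\,Y_{ni}$, $\mathbf{Y}_n^*=(Y_{n1}^*,\dots,Y_{nn}^* )^t$, and fix $\boldsymbol{\gamma}_0=(\gamma_{1,0},\dots,\gamma_{K,0})^t$ with all $\gamma_{k,0}>0$ and $\boldsymbol{\Gamma}_0=\mathrm{diag}(\boldsymbol{\gamma}_0)$. In the Bayesian model $(Y_{ni}^*\mid\mathbf{x}_i,\boldsymbol{\beta})$ independent $N(\mathbf{x}_i^t\boldsymbol{\beta},n)$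 with prior $\boldsymbol{\beta}\sim N(\mathbf{0},\boldsymbol{\Gamma}_0)$, let $\widehat{\boldsymbol{\beta}}_{nn}^*(\boldsymbol{\gamma}_0)=\mathbb{E}(\boldsymbol{\beta}\mid\boldsymbol{\gamma}_0,\mathbf{Y}_n^* )$ be the posterior mean. Then $\widehat{\boldsymbol{\beta}}_{nn}^*(\boldsymbol{\gamma}_0)$ converges in distribution to $Q(\cdot\mid\boldsymbol{\gamma}_0)$, the law of $(\boldsymbol{\Sigma}_0+\boldsymbol{\Gamma}_0^{-1})^{-1}(\boldsymbol{\Sigma}_0\boldsymbol{\beta}_0+\mathbf{Z})$ with $\mathbf{Z}\sim N(\mathbf{0},\boldsymbol{\Sigma}_0)$.
   Context: $\|\cdot\|$ is the Euclidean norm. Equivalently, $Q(\cdot\mid\boldsymbol{\gamma}_0)$ is a normal distribution with mean $\mathbf{V}_0^{-1}\boldsymbol{\beta}_0$, where $\mathbf{V}_0=\mathbf{I}+\boldsymbol{\Sigma}_0^{-1}\boldsymbol{\Gamma}_0^{-1}$, and covariance $(\boldsymbol{\Sigma}_0+\boldsymbol{\Gamma}_0^{-1})^{-1}\boldsymbol{\Sigma}_0(\boldsymbol{\Sigma}_0+\boldsymbol{\Gamma}_0^{-1})^{-1}$. *)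

theory Defs
  imports "HOL-Probability.Probability"
begin

definition pos_def_mat :: "real^'k^'k \<Rightarrow> bool" where
  "pos_def_mat A \<longleftrightarrow> transpose A = A \<and> (\<forall>v. v \<noteq> 0 \<longrightarrow> v \<bullet> (A *v v) > 0)"

definition gram :: "nat \<Rightarrow> (nat \<Rightarrow> real^'k) \<Rightarrow> real^'k^'k" where
  "gram n x = (\<chi> j l. \<Sum>i<n. (x i $ j) * (x i $ l))"

definition diag_mat :: "real^'k \<Rightarrow> real^'k^'k" where
  "diag_mat g = (\<chi> i j. if i = j then g $ i else 0)"

definition mvnormal0 :: "real^'k^'k \<Rightarrow> (real^'k) measure" where
  "mvnormal0 S = density lborel (\<lambda>z. ennreal (exp (- (z \<bullet> (matrix_inv S *v z)) / 2)
        / sqrt ((2 * pi) ^ CARD('k) * det S)))"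

text \<open>Posterior mean E(beta | gamma, y) in the Bayesian model
  y_i | beta independent N(x_i^t beta, n) (i < n), prior beta ~ N(0, diag gamma),
  defined by Bayes' formula (ratio of Lebesgue integrals).\<close>
definition post_weight :: "nat \<Rightarrow> (nat \<Rightarrow> real^'k) \<Rightarrow> (nat \<Rightarrow> real) \<Rightarrow> real^'k \<Rightarrow> real^'k \<Rightarrow> real" where
  "post_weight n x y g b =
     (\<Prod>i<n. normal_density (x i \<bullet> b) (sqrt (real n)) (y i)) *
     (\<Prod>k\<in>UNIV. normal_density 0 (sqrt (g $ k)) (b $ k))"

definition posterior_mean :: "nat \<Rightarrow> (nat \<Rightarrow> real^'k) \<Rightarrow> (nat \<Rightarrow> real) \<Rightarrow> real^'k \<Rightarrow> real^'k" where
  "posterior_mean n x y g =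
     (1 / (\<integral>b. post_weight n x y g b \<partial>lborel)) *\<^sub>R (\<integral>b. post_weight n x y g b *\<^sub>R b \<partial>lborel)"

definition conv_in_distr :: "(nat \<Rightarrow> 'a measure) \<Rightarrow> (nat \<Rightarrow> 'a \<Rightarrow> 'b::metric_space) \<Rightarrow> 'b measure \<Rightarrow> bool" where
  "conv_in_distr Ms X L \<longleftrightarrow>
     (\<forall>f :: 'b \<Rightarrow> real. continuous_on UNIV f \<and> bounded (range f) \<longrightarrow>
        (\<lambda>n. \<integral>\<omega>. f (X n \<omega>) \<partial>Ms n) \<longlonglongrightarrow> (\<integral>y. f y \<partial>L))"

end

theory Submission
  imports Defs "HOL-Real_Asymp.Real_Asymp"
begin

text \<open>Completing the square in \<open>post_weight\<close> identifies the posterior mean as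
  \<open>A\<^sub>n\<^sup>-\<^sup>1 (S\<^sub>n \<beta>\<^sub>0 + W\<^sub>n)\<close> with \<open>S\<^sub>n = X\<^sup>tX/n\<close>,
  \<open>A\<^sub>n = S\<^sub>n + \<Gamma>\<^sub>0\<^sup>-\<^sup>1\<close> and \<open>W\<^sub>n = \<Sum> \<epsilon>\<^sub>n\<^sub>i x\<^sub>i / \<surd>n\<close>. Since
  \<open>A\<^sub>n\<close> is symmetric, a linear functional \<open>t\<close> of it is a weighted sum of the errors with
  weights \<open>(A\<^sub>n\<^sup>-\<^sup>1 t) \<bullet> x\<^sub>i / \<surd>n\<close> plus a convergent constant, so that a Lyapunov estimate of
  characteristic functions gives the limit of \<open>E cos (t \<bullet> \<dots> + c)\<close> without any appeal to
  Slutsky's lemma. Linear combinations of these cosines form an algebra to which Stone--Weierstrass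
  applies, and with bounded second moments this is enough for convergence in distribution.
  On the limit side, a factorisation \<open>\<Sigma>\<^sub>0 = L L\<^sup>t\<close> and a linear change of variables reduce
  \<open>mvnormal0\<close> to a product of standard normal laws.\<close>

section \<open>Trigonometric polynomials and convergence in distribution\<close>

text \<open>The free phase \<open>c\<close> makes sines and constants (\<open>t = 0\<close>)
  available from a single real generator, so the product formula for two cosines already yields an
  algebra.\<close>

inductive_set trig_polys :: "('a::euclidean_space \<Rightarrow> real) set" where
  cos: "(\<lambda>x. cos (t \<bullet> x + c)) \<in> trig_polys"
| add: "f \<in> trig_polys \<Longrightarrow> g \<in> trig_polys \<Longrightarrow> (\<lambda>x. f x + g x) \<in> trig_polys"
| scale: "f \<in> trig_polys \<Longrightarrow> (\<lambda>x. a * f x) \<in> trig_polys"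

lemma trig_polys_const: "(\<lambda>x. a) \<in> trig_polys"
  using trig_polys.scale[OF trig_polys.cos[of 0 0], of a] by simp

lemma trig_polys_cos_mult:
  assumes "g \<in> trig_polys"
  shows "(\<lambda>x. cos (t \<bullet> x + c) * g x) \<in> trig_polys"
  using assms
proof induction
  case (cos s d)
  have "(\<lambda>x. cos (t \<bullet> x + c) * cos (s \<bullet> x + d)) =
        (\<lambda>x. (1/2) * (cos ((t - s) \<bullet> x + (c - d)) + cos ((t + s) \<bullet> x + (c + d))))"
    by (simp add: cos_times_cos inner_simps algebra_simps add_divide_distrib)
  then show ?case
    by (simp only: trig_polys.intros)
next
  case (add f g)
  then show ?case
    using trig_polys.add[OF add.IH] by (simp add: distrib_left)
next
  case (scale f a)
  then show ?case
    using trig_polys.scale[OF scale.IH, of a] by (simp add: mult.left_commute)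
qed

lemma trig_polys_mult:
  assumes "f \<in> trig_polys" "g \<in> trig_polys"
  shows "(\<lambda>x. f x * g x) \<in> trig_polys"
  using assms
proof induction
  case (cos t c)
  then show ?case
    by (rule trig_polys_cos_mult)
next
  case (add f1 f2)
  then show ?case
    using trig_polys.add[of "\<lambda>x. f1 x * g x" "\<lambda>x. f2 x * g x"] by (simp add: distrib_right)
next
  case (scale f a)
  then show ?case
    using trig_polys.scale[of "\<lambda>x. f x * g x" a] by (simp add: mult.assoc)
qed

text \<open>An algebra with constants absorbs polynomials in its members. Serves to bound
  approximants on the whole space.\<close>

lemma trig_polys_compose_polynomial:
  fixes P :: "real \<Rightarrow> real"
  assumes "real_polynomial_function P" "f \<in> trig_polys"
  shows "(\<lambda>x. P (f x)) \<in> trig_polys"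
  using assms
proof induction
  case (linear P)
  then interpret bounded_linear P by simp
  have "(\<lambda>x. P (f x)) = (\<lambda>x. P 1 * f x)"
  proof
    fix x
    show "P (f x) = P 1 * f x"
      using scaleR[of "f x" 1] by (simp add: mult.commute)
  qed
  then show ?case
    using trig_polys.scale[OF linear.prems, of "P 1"] by simp
next
  case (const c)
  show ?case by (rule trig_polys_const)
next
  case (add P Q)
  then show ?case by (intro trig_polys.add)
next
  case (mult P Q)
  then show ?case by (intro trig_polys_mult)
qed

lemma trig_polys_continuous:
  assumes "f \<in> trig_polys"
  shows "continuous_on A f"
  using assms by induction (auto intro!: continuous_intros)

lemma trig_polys_bounded:
  assumes "f \<in> trig_polys"
  shows "\<exists>B. \<forall>x. \<bar>f x\<bar> \<le> B"
  using assms
proof induction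
  case (cos t c)
  then show ?case by (intro exI[of _ 1]) simp
next
  case (add f g)
  then obtain A B where "\<forall>x. \<bar>f x\<bar> \<le> A" "\<forall>x. \<bar>g x\<bar> \<le> B" by blast
  then show ?case
    by (intro exI[of _ "A + B"] allI order_trans[OF abs_triangle_ineq] add_mono) auto
next
  case (scale f a)
  then obtain A where "\<forall>x. \<bar>f x\<bar> \<le> A" by blast
  then show ?case
    by (intro exI[of _ "\<bar>a\<bar> * A"]) (simp add: abs_mult mult_left_mono)
qed

text \<open>Stone--Weierstrass controls the approximant only on the ball. Composing with a polynomial
  close to the truncation to \<open>[-B, B]\<close> keeps it bounded everywhere and stays in the algebra.\<close>

lemma trig_polys_approx:
  fixes f :: "'a::euclidean_space \<Rightarrow> real"
  assumes f: "continuous_on UNIV f" "\<And>x. \<bar>f x\<bar> \<le> B" and e: "e > 0"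
  obtains q where "q \<in> trig_polys" "\<And>x. norm x \<le> R \<Longrightarrow> \<bar>f x - q x\<bar> < e" "\<And>x. \<bar>q x\<bar> \<le> B + e"
proof -
  interpret function_ring_on "trig_polys :: ('a \<Rightarrow> real) set" "cball 0 R"
  proof
    fix x y :: 'a assume "x \<noteq> y"
    \<comment> \<open>Scaled so that the phases of \<open>x\<close> and \<open>y\<close> differ by
      \<open>pi\<close>: the cosine centred at \<open>y\<close> is 1 at \<open>y\<close> and -1 at
      \<open>x\<close>.\<close>
    define t where "t = (pi / ((x - y) \<bullet> (x - y))) *\<^sub>R (x - y)"
    have "t \<bullet> x - t \<bullet> y = t \<bullet> (x - y)"
      by (simp add: inner_diff_right)
    also have "\<dots> = pi"
      using \<open>x \<noteq> y\<close> by (simp add: t_def)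
    finally have "cos (t \<bullet> x + - (t \<bullet> y)) \<noteq> cos (t \<bullet> y + - (t \<bullet> y))"
      by simp
    then show "\<exists>f\<in>trig_polys. f x \<noteq> f y"
      using trig_polys.cos[of t "- (t \<bullet> y)"] by (intro bexI)
  qed (auto intro: trig_polys.intros trig_polys_const trig_polys_mult trig_polys_continuous)
  have "continuous_on (cball 0 R) f"
    using f(1) by (rule continuous_on_subset) simp
  then obtain p where p: "p \<in> trig_polys" "\<And>x. norm x \<le> R \<Longrightarrow> \<bar>f x - p x\<bar> < e / 2"
    using Stone_Weierstrass_basic[of f "e / 2"] e by auto
  obtain K where K: "\<And>x. \<bar>p x\<bar> \<le> K"
    using trig_polys_bounded[OF p(1)] by blast
  define clip where "clip y = max (- B) (min B y)" for y :: real
  have "continuous_on {- K..K} clip"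
    unfolding clip_def by (intro continuous_intros)
  \<comment> \<open>\<open>K\<close> bounds \<open>p\<close> on the whole space, not only on the
    ball, so the estimate for \<open>P (p x)\<close> holds at every point.\<close>
  then obtain P where P: "real_polynomial_function P" "\<And>y. y \<in> {- K..K} \<Longrightarrow> \<bar>clip y - P y\<bar> < e / 2"
    using Stone_Weierstrass_real_polynomial_function[of "{- K..K}" clip "e / 2"] e by auto
  have Pp: "\<bar>clip (p x) - P (p x)\<bar> < e / 2" for x
    using P(2)[of "p x"] K[of x] by (simp add: abs_le_iff)
  show thesis
  proof
    show "(\<lambda>x. P (p x)) \<in> trig_polys"
      using P(1) p(1) by (rule trig_polys_compose_polynomial)
    \<comment> \<open>\<open>clip\<close> fixes \<open>f x\<close> and is 1-Lipschitz, so the errors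
      of \<open>p\<close> and of \<open>P\<close> just add.\<close>
    show "\<bar>f x - P (p x)\<bar> < e" if "norm x \<le> R" for x
      using Pp[of x] p(2)[OF that] f(2)[of x] unfolding clip_def by linarith
    show "\<bar>P (p x)\<bar> \<le> B + e" for x
      using Pp[of x] f(2)[of x] e unfolding clip_def by linarith
  qed
qed

text \<open>Integrability goes through the induction together with the limit because additivity of
  the integral needs it.\<close>

lemma trig_polys_integral_tendsto:
  fixes X :: "nat \<Rightarrow> 'a \<Rightarrow> 'b::euclidean_space"
  assumes prob: "\<And>n. prob_space (Ms n)" and X: "\<And>n. X n \<in> borel_measurable (Ms n)"
    and L: "prob_space L" "sets L = sets borel"
    and cos: "\<And>t c. (\<lambda>n. \<integral>\<omega>. cos (t \<bullet> X n \<omega> + c) \<partial>Ms n) \<longlonglongrightarrow> (\<integral>y. cos (t \<bullet> y + c) \<partial>L)"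
    and f: "f \<in> trig_polys"
  shows "(\<forall>n. integrable (Ms n) (\<lambda>\<omega>. f (X n \<omega>))) \<and> integrable L f \<and>
         (\<lambda>n. \<integral>\<omega>. f (X n \<omega>) \<partial>Ms n) \<longlonglongrightarrow> (\<integral>y. f y \<partial>L)"
  using f
proof induction
  case (cos t c)
  have "integrable (Ms n) (\<lambda>\<omega>. cos (t \<bullet> X n \<omega> + c))" for n
  proof -
    interpret prob_space "Ms n" by (rule prob)
    note X[measurable]
    show ?thesis by (rule integrable_const_bound[of _ 1]) auto
  qed
  moreover have "integrable L (\<lambda>y. cos (t \<bullet> y + c))"
  proof -
    interpret prob_space L by (rule L)
    show ?thesis
      by (rule integrable_const_bound[of _ 1]) (auto simp: measurable_cong_sets[OF L(2) refl])
  qed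
  ultimately show ?case using assms(5) by blast
next
  case (add f g)
  then show ?case by (auto intro: tendsto_add)
next
  case (scale f a)
  then show ?case by (auto intro: tendsto_mult)
qed

text \<open>A form of the continuity theorem: bounded second moments give tightness by Chebyshev, so
  \<open>f\<close> may be replaced by a trigonometric polynomial that is close to it on a large ball
  and bounded outside; for that polynomial the hypothesis on cosines gives the limit.\<close>

lemma conv_in_distrI_cos:
  fixes X :: "nat \<Rightarrow> 'a \<Rightarrow> 'b::euclidean_space"
  assumes prob: "\<And>n. prob_space (Ms n)" and X: "\<And>n. X n \<in> borel_measurable (Ms n)"
    and L: "prob_space L" "sets L = sets borel"
    and cos: "\<And>t c. (\<lambda>n. \<integral>\<omega>. cos (t \<bullet> X n \<omega> + c) \<partial>Ms n) \<longlonglongrightarrow> (\<integral>y. cos (t \<bullet> y + c) \<partial>L)"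
    and sq: "\<forall>\<^sub>F n in sequentially. integrable (Ms n) (\<lambda>\<omega>. (norm (X n \<omega>))\<^sup>2) \<and>
               (\<integral>\<omega>. (norm (X n \<omega>))\<^sup>2 \<partial>Ms n) \<le> C"
  shows "conv_in_distr Ms X L"
  unfolding conv_in_distr_def
proof (intro allI impI)
  fix f :: "'b \<Rightarrow> real" assume f: "continuous_on UNIV f \<and> bounded (range f)"
  then obtain B where B: "\<And>x. \<bar>f x\<bar> \<le> B" "B > 0"
    unfolding bounded_pos by auto
  interpret L: prob_space L by (rule L)
  have [measurable]: "f \<in> borel_measurable borel"
    using f by (intro borel_measurable_continuous_onI) auto
  have [measurable_cong]: "sets L = sets borel" by (rule L)
  have [simp]: "space L = UNIV" using sets_eq_imp_space_eq[OF L(2)] by simp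
  \<comment> \<open>For \<open>L\<close> itself no moment bound is used: the mass that a single
    probability measure puts outside growing balls vanishes by dominated convergence.\<close>
  have tail: "(\<lambda>m. \<integral>y. (indicator {y. real m < norm y} y :: real) \<partial>L) \<longlonglongrightarrow> (\<integral>y. 0 \<partial>L)"
  proof (rule integral_dominated_convergence[where w="\<lambda>_. 1" and f="\<lambda>_. 0::real"
      and s="\<lambda>m. indicator {y::'b. real m < norm y} :: 'b \<Rightarrow> real"])
    show "AE y in L. (\<lambda>m. indicator {y. real m < norm y} y :: real) \<longlonglongrightarrow> 0"
    proof (intro AE_I2 tendsto_eventually)
      fix y :: 'b
      show "\<forall>\<^sub>F m in sequentially. (indicator {y. real m < norm y} y :: real) = 0"
        using eventually_ge_at_top[of "nat \<lceil>norm y\<rceil>"]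
        by eventually_elim (auto simp: indicator_def nat_le_iff ceiling_le_iff)
    qed
  qed auto
  show "(\<lambda>n. \<integral>\<omega>. f (X n \<omega>) \<partial>Ms n) \<longlonglongrightarrow> (\<integral>y. f y \<partial>L)"
  proof (rule tendstoI)
    fix e :: real assume "e > 0"
    \<comment> \<open>The budget: \<open>2 * d\<close> for \<open>L\<close>, \<open>2 * d\<close>
      for \<open>Ms n\<close> and \<open>d\<close> for the trigonometric polynomial, so
      \<open>5 * d < e\<close> in all.\<close>
    define d where "d = e / 6"
    have d: "d > 0" using \<open>e > 0\<close> by (simp add: d_def)
    have "\<forall>\<^sub>F m in sequentially. (\<integral>y. (indicator {y. real m < norm y} y :: real) \<partial>L) < d / (2 * B)"
      using order_tendstoD(2)[OF tail, of "d / (2 * B)"] d B(2) by simp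
    moreover have "(\<lambda>m. 2 * B * C / (real m)\<^sup>2) \<longlonglongrightarrow> 0"
      by real_asymp
    then have "\<forall>\<^sub>F m in sequentially. 2 * B * C / (real m)\<^sup>2 < d"
      using d by (rule order_tendstoD)
    ultimately have "\<forall>\<^sub>F m in sequentially. (\<integral>y. (indicator {y. real m < norm y} y :: real) \<partial>L) < d / (2 * B)
        \<and> 2 * B * C / (real m)\<^sup>2 < d \<and> 0 < m"
      using eventually_gt_at_top[of 0] by eventually_elim simp
    then obtain m where m: "(\<integral>y. (indicator {y. real m < norm y} y :: real) \<partial>L) < d / (2 * B)"
        "2 * B * C / (real m)\<^sup>2 < d" "0 < m"
      by (auto simp: eventually_sequentially)
    obtain q where q: "q \<in> trig_polys" "\<And>x. norm x \<le> real m \<Longrightarrow> \<bar>f x - q x\<bar> < d" "\<And>x. \<bar>q x\<bar> \<le> B + d"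
      using trig_polys_approx[of f B d "real m"] f B(1) d by blast
    have [measurable]: "q \<in> borel_measurable borel"
      by (intro borel_measurable_continuous_onI trig_polys_continuous q)
    \<comment> \<open>Outside the ball the sup bounds \<open>B\<close> for \<open>f\<close> and
      \<open>B + d\<close> for \<open>q\<close> give \<open>2 * B + d\<close>.\<close>
    have fq: "\<bar>f x - q x\<bar> \<le> d + 2 * B * indicator {y. real m < norm y} x" for x
      using q(2)[of x] q(3)[of x] B(1)[of x] by (auto simp: indicator_def)
    \<comment> \<open>Chebyshev's inequality in pointwise form, ready to be integrated against the
      bound \<open>C\<close>.\<close>
    have fq2: "\<bar>f x - q x\<bar> \<le> d + 2 * B / (real m)\<^sup>2 * (norm x)\<^sup>2" for x
    proof -
      have "indicator {y. real m < norm y} x \<le> (norm x)\<^sup>2 / (real m)\<^sup>2"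
      proof (cases "real m < norm x")
        case True
        then have "(real m)\<^sup>2 \<le> (norm x)\<^sup>2" by (intro power_mono) auto
        then show ?thesis using m(3) by (auto simp: indicator_def)
      qed (auto simp: indicator_def)
      then have "2 * B * indicator {y. real m < norm y} x \<le> 2 * B * ((norm x)\<^sup>2 / (real m)\<^sup>2)"
        using B(2) by (intro mult_left_mono) auto
      then show ?thesis using fq[of x] by (simp add: field_simps)
    qed
    note conv = trig_polys_integral_tendsto[OF prob X L cos q(1)]
    have intL: "integrable L f" "integrable L q"
      using conv by (auto intro!: L.integrable_const_bound[of _ B] simp: B)
    have ind: "integrable L (indicator {y. real m < norm y} :: 'b \<Rightarrow> real)"
      by (rule L.integrable_const_bound[of _ 1]) auto
    have "\<bar>(\<integral>y. f y \<partial>L) - (\<integral>y. q y \<partial>L)\<bar> = \<bar>\<integral>y. f y - q y \<partial>L\<bar>"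
      using intL by simp
    also have "\<dots> \<le> (\<integral>y. \<bar>f y - q y\<bar> \<partial>L)" by (rule integral_abs_bound)
    also have "\<dots> \<le> (\<integral>y. d + 2 * B * (indicator {y. real m < norm y} y :: real) \<partial>L)"
      using intL ind by (intro integral_mono fq) auto
    also have "\<dots> = d + 2 * B * (\<integral>y. (indicator {y. real m < norm y} y :: real) \<partial>L)"
      using L.prob_space ind by (subst Bochner_Integration.integral_add) auto
    also have "\<dots> \<le> 2 * d"
      using m(1) B(2) by (simp add: field_simps)
    finally have 1: "\<bar>(\<integral>y. f y \<partial>L) - (\<integral>y. q y \<partial>L)\<bar> \<le> 2 * d" .
    have "\<forall>\<^sub>F n in sequentially. dist (\<integral>\<omega>. q (X n \<omega>) \<partial>Ms n) (\<integral>y. q y \<partial>L) < d"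
      using conv d tendstoD by blast
    with sq show "\<forall>\<^sub>F n in sequentially. dist (\<integral>\<omega>. f (X n \<omega>) \<partial>Ms n) (\<integral>y. f y \<partial>L) < e"
    proof eventually_elim
      case (elim n)
      interpret M: prob_space "Ms n" by (rule prob)
      note X[measurable]
      have intM: "integrable (Ms n) (\<lambda>\<omega>. f (X n \<omega>))" "integrable (Ms n) (\<lambda>\<omega>. q (X n \<omega>))"
        using conv by (auto intro!: M.integrable_const_bound[of _ B] simp: B)
      have "\<bar>(\<integral>\<omega>. f (X n \<omega>) \<partial>Ms n) - (\<integral>\<omega>. q (X n \<omega>) \<partial>Ms n)\<bar> = \<bar>\<integral>\<omega>. f (X n \<omega>) - q (X n \<omega>) \<partial>Ms n\<bar>"
        using intM by simp
      also have "\<dots> \<le> (\<integral>\<omega>. \<bar>f (X n \<omega>) - q (X n \<omega>)\<bar> \<partial>Ms n)" by (rule integral_abs_bound)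
      also have "\<dots> \<le> (\<integral>\<omega>. d + 2 * B / (real m)\<^sup>2 * (norm (X n \<omega>))\<^sup>2 \<partial>Ms n)"
        using intM elim by (intro integral_mono fq2) auto
      also have "\<dots> = d + 2 * B / (real m)\<^sup>2 * (\<integral>\<omega>. (norm (X n \<omega>))\<^sup>2 \<partial>Ms n)"
        using elim M.prob_space by (subst Bochner_Integration.integral_add) auto
      also have "\<dots> \<le> d + 2 * B / (real m)\<^sup>2 * C"
        using elim B(2) by (intro add_left_mono mult_left_mono) auto
      also have "\<dots> \<le> 2 * d" using m(2) by simp
      finally show ?case
        using 1 elim d unfolding dist_real_def d_def by linarith
    qed
  qed
qed

section \<open>Linear change of variables\<close>

text \<open>The change of variables theorems of the library need a well-ordered index type, which a
  general finite \<open>'k\<close> is not.\<close>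

lemma bij_betw_axis_Basis: "bij_betw (\<lambda>k. axis k 1) UNIV (Basis :: (real^'k) set)"
  by (auto simp: bij_betw_def inj_def axis_eq_axis Basis_vec_def)

text \<open>By Fubini in the coordinate \<open>b\<close>: with the others fixed, \<open>h\<close> is
  constant along \<open>b\<close>, so the inner integral is merely translated.\<close>

lemma nn_integral_lborel_shear:
  fixes g :: "'a::euclidean_space \<Rightarrow> ennreal" and h :: "'a \<Rightarrow> real"
  assumes [measurable]: "g \<in> borel_measurable borel" "h \<in> borel_measurable borel"
    and b: "b \<in> Basis" and h: "\<And>x s. h (x + s *\<^sub>R b) = h x"
  shows "(\<integral>\<^sup>+x. g (x + h x *\<^sub>R b) \<partial>lborel) = (\<integral>\<^sup>+x. g x \<partial>lborel)"
proof -
  interpret product_sigma_finite "\<lambda>_::'a. lborel :: real measure" ..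
  define E where "E = (\<lambda>x. \<Sum>c\<in>Basis. x c *\<^sub>R (c::'a))"
  have [measurable]: "E \<in> borel_measurable (Pi\<^sub>M Basis (\<lambda>_. lborel))"
    unfolding E_def by measurable
  \<comment> \<open>\<open>E'\<close> omits the coordinate \<open>b\<close>, which writes every
    point as \<open>E' x + y *\<^sub>R b\<close>.\<close>
  define E' where "E' = (\<lambda>x. \<Sum>c\<in>Basis - {b}. x c *\<^sub>R (c::'a))"
  have E_upd: "E (x(b := y)) = E' x + y *\<^sub>R b" for x y
    unfolding E_def E'_def by (subst sum.remove[OF finite_Basis b]) (auto simp: add.commute intro!: sum.cong)
  have split: "(\<integral>\<^sup>+x. f x \<partial>lborel) =
      (\<integral>\<^sup>+x. \<integral>\<^sup>+y. f (E' x + y *\<^sub>R b) \<partial>lborel \<partial>Pi\<^sub>M (Basis - {b}) (\<lambda>_. lborel))"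
    if [measurable]: "f \<in> borel_measurable borel" for f :: "'a \<Rightarrow> ennreal"
  proof -
    have "(\<integral>\<^sup>+x. f x \<partial>lborel) = (\<integral>\<^sup>+x. f (E x) \<partial>Pi\<^sub>M Basis (\<lambda>_. lborel))"
      by (subst lborel_eq) (simp add: nn_integral_distr E_def)
    also have "\<dots> = (\<integral>\<^sup>+x. \<integral>\<^sup>+y. f (E (x(b := y))) \<partial>lborel \<partial>Pi\<^sub>M (Basis - {b}) (\<lambda>_. lborel))"
      using product_nn_integral_insert[of "Basis - {b}" b "\<lambda>x. f (E x)"] b
      by (simp add: insert_absorb)
    finally show ?thesis unfolding E_upd .
  qed
  have inner: "(\<integral>\<^sup>+y. g (z + y *\<^sub>R b + h (z + y *\<^sub>R b) *\<^sub>R b) \<partial>lborel) = (\<integral>\<^sup>+y. g (z + y *\<^sub>R b) \<partial>lborel)" for z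
    using nn_integral_real_affine[of "\<lambda>y. g (z + y *\<^sub>R b)" 1 "h z"]
    by (simp add: h algebra_simps)
  show ?thesis
    unfolding split[OF assms(1)] by (subst split) (simp_all only: inner, measurable)
qed

text \<open>Every linear map is composed of elementary ones and the determinant is multiplicative,
  so it is enough to treat scalings, transpositions and shears.\<close>

lemma nn_integral_lborel_linear:
  fixes f :: "real^'k \<Rightarrow> real^'k"
  assumes "linear f" and "det (matrix f) \<noteq> 0" and "g \<in> borel_measurable borel"
  shows "(\<integral>\<^sup>+x. g x \<partial>lborel) = ennreal \<bar>det (matrix f)\<bar> * (\<integral>\<^sup>+x. g (f x) \<partial>lborel)"
proof -
  \<comment> \<open>All \<open>g\<close> are quantified inside \<open>P\<close> because a
    composition applies the formula for \<open>f2\<close> to \<open>g\<close> after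
    \<open>f1\<close>. The premise on the determinant makes the singular case vacuous.\<close>
  define P where "P f \<longleftrightarrow> (det (matrix f) \<noteq> 0 \<longrightarrow> (\<forall>g\<in>borel_measurable borel.
    (\<integral>\<^sup>+x. g x \<partial>lborel) = ennreal \<bar>det (matrix f)\<bar> * (\<integral>\<^sup>+x. g (f x) \<partial>lborel)))" for f :: "real^'k \<Rightarrow> real^'k"
  have "P f"
  proof (rule induct_linear_elementary[OF \<open>linear f\<close>])
    fix f1 f2 :: "real^'k \<Rightarrow> real^'k" assume lin: "linear f1" "linear f2" and P: "P f1" "P f2"
    have [measurable]: "f1 \<in> borel_measurable borel"
      using lin(1) by (intro borel_measurable_continuous_onI linear_continuous_on) (simp add: linear_linear)
    show "P (f1 \<circ> f2)"
      unfolding P_def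
    proof (intro impI ballI)
      fix g :: "real^'k \<Rightarrow> ennreal" assume [measurable]: "g \<in> borel_measurable borel"
      assume "det (matrix (f1 \<circ> f2)) \<noteq> 0"
      then have nz: "det (matrix f1) \<noteq> 0" "det (matrix f2) \<noteq> 0"
        by (simp_all add: matrix_compose lin det_mul)
      have "(\<lambda>x. g (f1 x)) \<in> borel_measurable borel" by measurable
      then show "(\<integral>\<^sup>+x. g x \<partial>lborel) = ennreal \<bar>det (matrix (f1 \<circ> f2))\<bar> * (\<integral>\<^sup>+x. g ((f1 \<circ> f2) x) \<partial>lborel)"
        using P nz \<open>g \<in> borel_measurable borel\<close> unfolding P_def
        by (simp add: matrix_compose lin det_mul abs_mult ennreal_mult mult.assoc)
    qed
  next
    fix f :: "real^'k \<Rightarrow> real^'k" and i assume "linear f" and 0: "\<And>x. f x $ i = 0"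
    have "row i (matrix f) = 0"
      using 0 by (simp add: row_def matrix_def vec_eq_iff)
    then show "P f"
      unfolding P_def by (simp add: det_zero_row)
  next
    fix c :: "'k \<Rightarrow> real"
    have M: "matrix (\<lambda>x::real^'k. \<chi> i. c i * x $ i) = (\<chi> i j. if i = j then c i else 0)"
      by (simp add: matrix_def axis_def vec_eq_iff)
    have det: "det (matrix (\<lambda>x::real^'k. \<chi> i. c i * x $ i)) = (\<Prod>i\<in>UNIV. c i)"
      by (simp add: M det_diagonal)
    show "P (\<lambda>x. \<chi> i. c i * x $ i)"
      unfolding P_def det
    proof (intro impI ballI)
      fix g :: "real^'k \<Rightarrow> ennreal" assume [measurable]: "g \<in> borel_measurable borel"
      assume "(\<Prod>i\<in>UNIV. c i) \<noteq> 0"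
      then have c: "c i \<noteq> 0" for i by simp
      \<comment> \<open>\<open>C\<close> transfers the factors \<open>c\<close> from indices to
        basis vectors, the indexing used by \<open>lborel_affine_euclidean\<close>.\<close>
      define C where "C b = (\<Sum>k\<in>UNIV. c k * (b $ k))" for b :: "real^'k"
      have C: "C (axis k 1) = c k" for k
        by (simp add: C_def axis_def if_distrib cong: if_cong)
      have "(\<Sum>j\<in>Basis. (C j * (x \<bullet> j)) *\<^sub>R j) = (\<Sum>k\<in>UNIV. (c k * x $ k) *\<^sub>R axis k 1)" for x :: "real^'k"
        by (subst sum.reindex_bij_betw[OF bij_betw_axis_Basis, symmetric]) (simp add: C inner_axis)
      also have "\<dots> x = (\<chi> i. c i * x $ i)" for x :: "real^'k"
        by (simp add: vec_eq_iff axis_def if_distrib cong: if_cong)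
      finally have T: "(\<lambda>x::real^'k. 0 + (\<Sum>j\<in>Basis. (C j * (x \<bullet> j)) *\<^sub>R j)) = (\<lambda>x. \<chi> i. c i * x $ i)"
        by simp
      have "(\<Prod>j\<in>Basis. \<bar>C j\<bar>) = \<bar>\<Prod>i\<in>UNIV. c i\<bar>"
        by (subst prod.reindex_bij_betw[OF bij_betw_axis_Basis, symmetric]) (simp add: C abs_prod)
      moreover have "C j \<noteq> 0" if "j \<in> Basis" for j
        using that c C by (auto simp: Basis_vec_def)
      ultimately have lb: "lborel = density (distr lborel borel (\<lambda>x. \<chi> i. c i * x $ i)) (\<lambda>_. ennreal \<bar>\<Prod>i\<in>UNIV. c i\<bar>)"
        using lborel_affine_euclidean[of C 0] unfolding T by simp
      have [measurable]: "(\<lambda>x::real^'k. \<chi> i. c i * x $ i) \<in> borel_measurable borel"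
        unfolding T[symmetric] by simp
      show "(\<integral>\<^sup>+x. g x \<partial>lborel) = ennreal \<bar>\<Prod>i\<in>UNIV. c i\<bar> * (\<integral>\<^sup>+x. g (\<chi> i. c i * x $ i) \<partial>lborel)"
        by (subst lb) (simp add: nn_integral_density nn_integral_distr nn_integral_cmult)
    qed
  next
    fix m n :: 'k assume "m \<noteq> n"
    let ?h = "\<lambda>x::real^'k. \<chi> i. x $ Transposition.transpose m n i"
    have lin: "linear ?h"
      by (rule linearI) (simp_all add: vec_eq_iff)
    have perm: "Transposition.transpose m n permutes UNIV"
      by (simp add: permutes_swap_id)
    have "matrix ?h = (\<chi> i. mat 1 $ Transposition.transpose m n i)"
      by (auto simp: matrix_def axis_def mat_def vec_eq_iff)
    then have det: "\<bar>det (matrix ?h)\<bar> = 1"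
      using \<open>m \<noteq> n\<close> by (simp add: det_permute_rows[OF perm] sign_swap_id)
    have [measurable]: "?h \<in> borel_measurable borel"
      using lin by (intro borel_measurable_continuous_onI linear_continuous_on) (simp add: linear_linear)
    \<comment> \<open>Lebesgue measure is determined by its values on boxes, and swapping two
      coordinates takes boxes to boxes with the side lengths permuted.\<close>
    have lb: "lborel = distr lborel borel ?h"
    proof (rule lborel_eqI)
      fix l u :: "real^'k" assume le: "\<And>b. b \<in> Basis \<Longrightarrow> l \<bullet> b \<le> u \<bullet> b"
      have le': "l $ k \<le> u $ k" for k
        using le[of "axis k 1"] by (simp add: inner_axis axis_in_Basis_iff)
      have "?h -` box l u = box (?h l) (?h u)"
        by (auto simp: mem_box_cart) (metis transpose_involutory)+
      moreover have "?h l \<bullet> b \<le> ?h u \<bullet> b" if "b \<in> Basis" for b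
        using that le' by (auto simp: Basis_vec_def inner_axis)
      ultimately have "emeasure (distr lborel borel ?h) (box l u) = (\<Prod>b\<in>Basis. (?h u - ?h l) \<bullet> b)"
        by (simp add: emeasure_distr emeasure_lborel_box)
      also have "(\<Prod>b\<in>Basis. (?h u - ?h l) \<bullet> b) = (\<Prod>k\<in>UNIV. (u - l) $ Transposition.transpose m n k)"
        by (subst prod.reindex_bij_betw[OF bij_betw_axis_Basis, symmetric]) (simp add: inner_axis)
      also have "\<dots> = (\<Prod>k\<in>UNIV. (u - l) $ k)"
        using prod.permute[OF perm, of "\<lambda>k. (u - l) $ k"] by (simp add: o_def)
      also have "\<dots> = (\<Prod>b\<in>Basis. (u - l) \<bullet> b)"
        by (subst prod.reindex_bij_betw[OF bij_betw_axis_Basis, symmetric]) (simp add: inner_axis)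
      finally show "emeasure (distr lborel borel ?h) (box l u) = (\<Prod>b\<in>Basis. (u - l) \<bullet> b)" .
    qed simp
    have "(\<integral>\<^sup>+x. g x \<partial>lborel) = (\<integral>\<^sup>+x. g (?h x) \<partial>lborel)"
      if [measurable]: "g \<in> borel_measurable borel" for g :: "real^'k \<Rightarrow> ennreal"
      by (subst lb) (simp add: nn_integral_distr)
    then show "P ?h"
      unfolding P_def det ennreal_1 mult_1 by blast
  next
    fix m n :: 'k assume "m \<noteq> n"
    let ?h = "\<lambda>x::real^'k. \<chi> i. if i = m then x $ m + x $ n else x $ i"
    have "matrix ?h = (\<chi> k. if k = m then row m (mat 1) + 1 *s row n (mat 1) else row k (mat 1))"
      by (auto simp: matrix_def row_def mat_def axis_def vec_eq_iff)
    then have det: "det (matrix ?h) = 1"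
      using det_row_operation[OF \<open>m \<noteq> n\<close>, of "mat 1 :: real^'k^'k" 1] by simp
    \<comment> \<open>A shear along \<open>axis m 1\<close> by the amount \<open>x $ n\<close>,
      which does not change along that axis since \<open>m \<noteq> n\<close>.\<close>
    have h: "?h x = x + (x $ n) *\<^sub>R axis m 1" for x
      by (auto simp: vec_eq_iff axis_def)
    have [simp]: "axis m (1::real) $ n = 0"
      using \<open>m \<noteq> n\<close> by (simp add: axis_def)
    have "(\<integral>\<^sup>+x. g (?h x) \<partial>lborel) = (\<integral>\<^sup>+x. g x \<partial>lborel)"
      if "g \<in> borel_measurable borel" for g :: "real^'k \<Rightarrow> ennreal"
      unfolding h using that by (intro nn_integral_lborel_shear) auto
    then show "P ?h"
      unfolding P_def det by simp
  qed
  then show ?thesis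
    using assms unfolding P_def by blast
qed

section \<open>The multivariate normal law\<close>

lemma inner_transpose_mult: "(transpose A *v x) \<bullet> y = x \<bullet> (A *v y)" for A :: "real^'n^'m"
  by (simp add: dot_lmul_matrix)

lemma matrix_inv_unique:
  fixes A B :: "real^'n^'n"
  assumes "A ** B = mat 1"
  shows "matrix_inv A = B"
proof -
  have BA: "B ** A = mat 1"
    using assms by (rule matrix_left_right_inverse1)
  have "A ** matrix_inv A = mat 1 \<and> matrix_inv A ** A = mat 1"
    unfolding matrix_inv_def by (rule someI[of _ B]) (simp add: assms BA)
  then have "B ** (A ** matrix_inv A) = B" by simp
  then show ?thesis
    by (simp add: matrix_mul_assoc BA)
qed

section \<open>Positive definite matrices and their factorisation\<close>

lemma pos_def_mat_symmetric:
  "pos_def_mat S \<Longrightarrow> (S *v x) \<bullet> y = x \<bullet> (S *v y)"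
  unfolding pos_def_mat_def by (metis inner_transpose_mult)

lemma pos_def_mat_inverse:
  assumes "pos_def_mat S"
  shows "S ** matrix_inv S = mat 1" "matrix_inv S ** S = mat 1"
proof -
  have "S *v x = 0 \<Longrightarrow> x = 0" for x
    using assms unfolding pos_def_mat_def by (metis inner_zero_right less_irrefl)
  then obtain B where "B ** S = mat 1"
    using matrix_left_invertible_ker by blast
  then have "S ** B = mat 1"
    by (rule matrix_left_right_inverse1)
  then show "S ** matrix_inv S = mat 1" "matrix_inv S ** S = mat 1"
    using matrix_inv_unique[of S B] \<open>B ** S = mat 1\<close> by simp_all
qed

text \<open>Gram--Schmidt with respect to the inner product \<open>x \<bullet> (S *v y)\<close>.\<close>

lemma pos_def_mat_orthonormal_family:
  fixes S :: "real^'k^'k" and I :: "'k set"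
  assumes S: "pos_def_mat S"
  shows "\<exists>v. \<forall>i\<in>I. \<forall>j\<in>I. v i \<bullet> (S *v v j) = (if i = j then 1 else 0)"
proof (induction I rule: finite_induct[OF finite])
  case 1
  then show ?case by simp
next
  case (2 a I)
  then obtain v where v: "\<And>i j. i \<in> I \<Longrightarrow> j \<in> I \<Longrightarrow> v i \<bullet> (S *v v j) = (if i = j then 1 else 0)"
    by blast
  \<comment> \<open>As \<open>a\<close> is not in \<open>I\<close>, the vectors
    \<open>S *v v i\<close> are too few to span the space; a nonzero vector orthogonal to all of
    them is the next direction, so no projection has to be subtracted.\<close>
  have "dim ((\<lambda>i. S *v v i) ` I) \<le> card I"
    using 2(1) by (meson card_image_le dim_le_card' finite_imageI le_trans)
  also have "card I < card (insert a I)"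
    using 2(1,2) by simp
  also have "\<dots> \<le> CARD('k)"
    by (intro card_mono) auto
  finally have "dim ((\<lambda>i. S *v v i) ` I) < DIM(real^'k)"
    by simp
  then obtain w where w: "w \<noteq> 0" "\<And>y. y \<in> span ((\<lambda>i. S *v v i) ` I) \<Longrightarrow> orthogonal w y"
    using orthogonal_to_subspace_exists by blast
  have wv: "w \<bullet> (S *v v i) = 0" if "i \<in> I" for i
    using w(2)[of "S *v v i"] that by (simp add: orthogonal_def span_base)
  have vw: "v i \<bullet> (S *v w) = 0" if "i \<in> I" for i
    using wv[OF that] pos_def_mat_symmetric[OF S, of w "v i"] pos_def_mat_symmetric[OF S, of "v i" w]
    by (simp add: inner_commute)
  have ww: "w \<bullet> (S *v w) > 0"
    using S w(1) unfolding pos_def_mat_def by blast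
  define u where "u = (1 / sqrt (w \<bullet> (S *v w))) *\<^sub>R w"
  have "u \<bullet> (S *v u) = 1"
    using ww by (simp add: u_def matrix_vector_mult_scaleR field_simps)
  moreover have "u \<bullet> (S *v v i) = 0" "v i \<bullet> (S *v u) = 0" if "i \<in> I" for i
    using wv[OF that] vw[OF that] by (simp_all add: u_def matrix_vector_mult_scaleR)
  ultimately show ?case
    using v 2(2) by (intro exI[of _ "v(a := u)"]) auto
qed

text \<open>Taking an orthonormal family for the form of \<open>S\<close> as columns of
  \<open>V\<close> gives \<open>transpose V ** S ** V = mat 1\<close>. Then
  \<open>V ** transpose V\<close> inverts \<open>S\<close>, and \<open>L = S ** V\<close> is the
  required factor.\<close>

lemma pos_def_mat_factor:
  fixes S :: "real^'k^'k"
  assumes S: "pos_def_mat S"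
  obtains L V :: "real^'k^'k" where "L ** transpose L = S" "V ** transpose V = matrix_inv S" "transpose V ** L = mat 1"
proof -
  obtain v :: "'k \<Rightarrow> real^'k" where v: "\<And>i j. v i \<bullet> (S *v v j) = (if i = j then 1 else 0)"
    using pos_def_mat_orthonormal_family[OF S, of UNIV] by blast
  define V :: "real^'k^'k" where "V = (\<chi> i j. v j $ i)"
  have "(transpose V ** (S ** V)) $ i $ j = v i \<bullet> (S *v v j)" for i j
    by (simp add: matrix_matrix_mult_def transpose_def V_def inner_vec_def matrix_vector_mult_def)
  then have 1: "transpose V ** (S ** V) = mat 1"
    by (simp add: vec_eq_iff v mat_def)
  then have "(transpose V ** S) ** V = mat 1"
    by (simp add: matrix_mul_assoc)
  then have "V ** (transpose V ** S) = mat 1"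
    by (rule matrix_left_right_inverse1)
  then have VV: "(V ** transpose V) ** S = mat 1"
    by (simp add: matrix_mul_assoc)
  then have "S ** (V ** transpose V) = mat 1"
    by (rule matrix_left_right_inverse1)
  then have 2: "V ** transpose V = matrix_inv S"
    using matrix_inv_unique by metis
  have "S ** V ** transpose (S ** V) = S ** ((V ** transpose V) ** S)"
    using S by (simp add: matrix_transpose_mul matrix_mul_assoc pos_def_mat_def)
  also have "\<dots> = S"
    by (simp add: VV)
  finally show thesis
    using that[of "S ** V" V] 1 2 by simp
qed

text \<open>\<open>lborel\<close> is the image of a product measure, so Fubini applies. The values
  lie in a general normed field because both real densities and complex exponentials are to be
  integrated.\<close>

lemma
  fixes f :: "'a::euclidean_space \<Rightarrow> real \<Rightarrow> 'b::{real_normed_field,banach,second_countable_topology}"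
  assumes f: "\<And>b. b \<in> Basis \<Longrightarrow> integrable lborel (f b)"
  shows integrable_lborel_prod: "integrable lborel (\<lambda>x::'a. \<Prod>b\<in>Basis. f b (x \<bullet> b))"
    and integral_lborel_prod: "(\<integral>x. (\<Prod>b\<in>Basis. f b (x \<bullet> b)) \<partial>lborel) = (\<Prod>b\<in>Basis. \<integral>x. f b x \<partial>lborel)"
proof -
  interpret product_sigma_finite "\<lambda>_::'a. lborel :: real measure" ..
  have [measurable]: "\<And>b. b \<in> Basis \<Longrightarrow> f b \<in> borel_measurable borel"
    using f[THEN borel_measurable_integrable] by simp
  have eq: "(\<Prod>b\<in>Basis. f b ((\<Sum>c\<in>Basis. x c *\<^sub>R c) \<bullet> b)) = (\<Prod>b\<in>Basis. f b (x b))" for x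
    by (intro prod.cong) (simp_all add: inner_sum_left_Basis)
  show "integrable lborel (\<lambda>x::'a. \<Prod>b\<in>Basis. f b (x \<bullet> b))"
    by (subst lborel_eq) (auto simp: integrable_distr_eq eq intro!: product_integrable_prod f)
  show "(\<integral>x. (\<Prod>b\<in>Basis. f b (x \<bullet> b)) \<partial>lborel) = (\<Prod>b\<in>Basis. \<integral>x. f b x \<partial>lborel)"
    by (subst lborel_eq) (auto simp: integral_distr eq intro!: product_integral_prod f)
qed

section \<open>Standard normal law in product form and its linear images\<close>

definition std_mvnormal :: "(real^'k) measure" where
  "std_mvnormal = density lborel (\<lambda>u. ennreal (\<Prod>b\<in>Basis. std_normal_density (u \<bullet> b)))"

lemma sets_std_mvnormal [simp, measurable_cong]: "sets std_mvnormal = sets borel"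
  and space_std_mvnormal [simp]: "space std_mvnormal = UNIV"
  by (simp_all add: std_mvnormal_def)

lemma prob_space_std_mvnormal: "prob_space std_mvnormal"
proof
  have std: "(\<integral>\<^sup>+x. ennreal (std_normal_density x) \<partial>lborel) = 1"
    using prob_space.emeasure_space_1[OF prob_space_normal_density[of 1 0]]
    by (simp add: emeasure_density)
  show "emeasure (std_mvnormal :: (real^'k) measure) (space std_mvnormal) = 1"
    using nn_integral_lborel_prod[of "\<lambda>_::real^'k. std_normal_density"]
    by (simp add: std_mvnormal_def emeasure_density std prod_ennreal)
qed

text \<open>The exponential factors over coordinates just as the density does, which leaves a
  product of one-dimensional characteristic functions.\<close>

lemma std_mvnormal_char:
  "(\<integral>u. iexp (t \<bullet> u) \<partial>std_mvnormal) = complex_of_real (exp (- (t \<bullet> t) / 2))"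
proof -
  have eq: "(\<Prod>b\<in>Basis. std_normal_density (u \<bullet> b)) *\<^sub>R iexp (t \<bullet> u) =
      (\<Prod>b\<in>Basis. std_normal_density (u \<bullet> b) *\<^sub>R iexp ((t \<bullet> b) * (u \<bullet> b)))" for u :: "real^'a"
    by (subst euclidean_inner)
      (simp add: scaleR_conv_of_real prod.distrib exp_sum sum_distrib_left mult.assoc)
  have 1: "integrable lborel (\<lambda>x. std_normal_density x *\<^sub>R iexp (s * x))" for s
  proof -
    interpret std: prob_space std_normal_distribution
      by (rule prob_space_normal_density) simp
    have "integrable std_normal_distribution (\<lambda>x. iexp (s * x))"
      by (rule std.integrable_iexp) auto
    then show ?thesis
      by (subst (asm) integrable_density) auto
  qed
  have 2: "(\<integral>x. std_normal_density x *\<^sub>R iexp (s * x) \<partial>lborel) = complex_of_real (exp (- (s^2) / 2))" for s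
    using fun_cong[OF char_std_normal_distribution, of s]
    by (simp add: char_def integral_density)
  have "(\<integral>u. iexp (t \<bullet> u) \<partial>std_mvnormal) = (\<integral>u. (\<Prod>b\<in>Basis. std_normal_density (u \<bullet> b)) *\<^sub>R iexp (t \<bullet> u) \<partial>lborel)"
    unfolding std_mvnormal_def by (subst integral_density) (auto intro!: prod_nonneg)
  also have "\<dots> = (\<Prod>b\<in>Basis. \<integral>x. std_normal_density x *\<^sub>R iexp ((t \<bullet> b) * x) \<partial>lborel)"
    unfolding eq by (rule integral_lborel_prod) (rule 1)
  also have "\<dots> = (\<Prod>b\<in>Basis. complex_of_real (exp (- ((t \<bullet> b)\<^sup>2) / 2)))"
    by (simp only: 2)
  also have "\<dots> = complex_of_real (exp (\<Sum>b\<in>Basis. - ((t \<bullet> b)\<^sup>2) / 2))"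
    by (simp only: of_real_prod exp_sum[OF finite_Basis])
  also have "(\<Sum>b\<in>Basis. - ((t \<bullet> b)\<^sup>2) / 2) = - (t \<bullet> t) / 2"
    by (subst (2) euclidean_inner) (simp add: power2_eq_square sum_negf sum_divide_distrib)
  finally show ?thesis .
qed

text \<open>Substitute \<open>z = L *v u\<close>. The exponent reduces to
  \<open>u \<bullet> u\<close> because \<open>matrix_inv S = V ** transpose V\<close> and
  \<open>transpose V\<close> undoes \<open>L\<close>; the Jacobian cancels
  \<open>sqrt (det S) = \<bar>det L\<bar>\<close>.\<close>

lemma mvnormal0_eq_distr:
  fixes S L :: "real^'k^'k"
  assumes L: "L ** transpose L = S" "V ** transpose V = matrix_inv S" "transpose V ** L = mat 1"
  shows "mvnormal0 S = distr std_mvnormal borel ((*v) L)"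
proof (rule measure_eqI)
  fix X assume "X \<in> sets (mvnormal0 S)"
  then have [measurable]: "X \<in> sets borel" by (simp add: mvnormal0_def)
  have [measurable]: "(*v) A \<in> borel_measurable borel" for A :: "real^'k^'k"
    by (intro borel_measurable_continuous_onI linear_continuous_on matrix_vector_mul_bounded_linear)
  have det: "det S = (det L)\<^sup>2"
    unfolding L(1)[symmetric] by (simp add: det_mul power2_eq_square)
  have "det V * det L = 1"
    using arg_cong[OF L(3), of det] by (simp add: det_mul)
  then have nz: "det L \<noteq> 0" by auto
  define \<phi> where "\<phi> z = exp (- (z \<bullet> (matrix_inv S *v z)) / 2) / sqrt ((2 * pi) ^ CARD('k) * det S)" for z
  have [measurable]: "\<phi> \<in> borel_measurable borel"
    unfolding \<phi>_def by measurable
  have quad: "(L *v u) \<bullet> (matrix_inv S *v (L *v u)) = u \<bullet> u" for u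
  proof -
    have "transpose V *v (L *v u) = u"
      by (simp only: matrix_vector_mul_assoc L(3) matrix_vector_mul_lid)
    moreover have "(L *v u) \<bullet> (V *v (transpose V *v (L *v u))) = (transpose V *v (L *v u)) \<bullet> (transpose V *v (L *v u))"
      by (rule inner_transpose_mult[symmetric])
    ultimately show ?thesis
      unfolding L(2)[symmetric] by (simp only: matrix_vector_mul_assoc[symmetric])
  qed
  have dens: "\<bar>det L\<bar> * \<phi> (L *v u) = (\<Prod>b\<in>Basis. std_normal_density (u \<bullet> b))" for u
  proof -
    have "(\<Prod>b\<in>Basis. std_normal_density (u \<bullet> b)) = (1 / sqrt (2 * pi)) ^ CARD('k) * exp (\<Sum>b\<in>Basis. - (u \<bullet> b)\<^sup>2 / 2)"
      unfolding std_normal_density_def by (simp only: prod.distrib exp_sum[OF finite_Basis] prod_constant) simp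
    also have "(\<Sum>b\<in>Basis. - (u \<bullet> b)\<^sup>2 / 2) = - (u \<bullet> u) / 2"
      by (subst (2) euclidean_inner) (simp add: power2_eq_square sum_negf sum_divide_distrib)
    moreover have "sqrt ((2 * pi) ^ CARD('k) * det S) = sqrt (2 * pi) ^ CARD('k) * \<bar>det L\<bar>"
      by (simp only: det real_sqrt_mult[of "(2 * pi) ^ CARD('k)"] real_sqrt_abs real_sqrt_power[of "2 * pi"])
    ultimately show ?thesis
      using nz by (simp add: \<phi>_def quad power_divide)
  qed
  have "emeasure (mvnormal0 S) X = (\<integral>\<^sup>+z. ennreal (\<phi> z) * indicator X z \<partial>lborel)"
    unfolding mvnormal0_def \<phi>_def by (subst emeasure_density) auto
  also have "\<dots> = ennreal \<bar>det L\<bar> * (\<integral>\<^sup>+u. ennreal (\<phi> (L *v u)) * indicator X (L *v u) \<partial>lborel)"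
    using nz
    by (subst nn_integral_lborel_linear[of "(*v) L"]) (auto simp: matrix_of_matrix_vector_mul)
  also have "\<dots> = (\<integral>\<^sup>+u. ennreal (\<bar>det L\<bar> * \<phi> (L *v u)) * indicator X (L *v u) \<partial>lborel)"
    by (subst nn_integral_cmult[symmetric]) (auto simp: ennreal_mult' mult.assoc)
  also have "\<dots> = (\<integral>\<^sup>+u. ennreal (\<Prod>b\<in>Basis. std_normal_density (u \<bullet> b)) * indicator ((*v) L -` X) u \<partial>lborel)"
    by (simp add: dens indicator_def)
  also have "\<dots> = emeasure std_mvnormal ((*v) L -` X)"
    unfolding std_mvnormal_def
    using measurable_sets_borel[of "(*v) L" borel X] by (subst emeasure_density) auto
  also have "\<dots> = emeasure (distr std_mvnormal borel ((*v) L)) X"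
    by (subst emeasure_distr) auto
  finally show "emeasure (mvnormal0 S) X = emeasure (distr std_mvnormal borel ((*v) L)) X" .
qed (simp add: mvnormal0_def)

text \<open>Both facts are pulled back along a factor \<open>L\<close>: the functional
  \<open>t\<close> becomes \<open>s = transpose L *v t\<close> with
  \<open>s \<bullet> s = t \<bullet> (S *v t)\<close>, and the cosine is the real part of
  \<open>iexp (s \<bullet> u) * iexp c\<close>.\<close>

lemma
  fixes S :: "real^'k^'k"
  assumes S: "pos_def_mat S"
  shows prob_space_mvnormal0: "prob_space (mvnormal0 S)"
    and mvnormal0_cos: "(\<integral>z. cos (t \<bullet> z + c) \<partial>mvnormal0 S) = exp (- (t \<bullet> (S *v t)) / 2) * cos c"
proof -
  obtain L V :: "real^'k^'k" where L: "L ** transpose L = S" "V ** transpose V = matrix_inv S" "transpose V ** L = mat 1"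
    using pos_def_mat_factor[OF S] .
  note eq = mvnormal0_eq_distr[OF L]
  interpret std: prob_space "std_mvnormal :: (real^'k) measure" by (rule prob_space_std_mvnormal)
  have [measurable]: "(*v) L \<in> borel_measurable borel"
    by (intro borel_measurable_continuous_onI linear_continuous_on matrix_vector_mul_bounded_linear)
  show "prob_space (mvnormal0 S)"
    unfolding eq by (rule std.prob_space_distr) simp
  define s where "s = transpose L *v t"
  have s: "t \<bullet> (L *v u) = s \<bullet> u" for u
    unfolding s_def by (rule inner_transpose_mult[symmetric])
  have ss: "s \<bullet> s = t \<bullet> (S *v t)"
    unfolding s_def L(1)[symmetric]
    by (simp only: inner_transpose_mult matrix_vector_mul_assoc[symmetric])
  have "(\<integral>z. cos (t \<bullet> z + c) \<partial>mvnormal0 S) = (\<integral>u. cos (s \<bullet> u + c) \<partial>std_mvnormal)"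
    unfolding eq by (subst integral_distr) (simp_all add: s)
  also have "\<dots> = (\<integral>u. Re (iexp (s \<bullet> u) * iexp c) \<partial>std_mvnormal)"
    by (simp add: exp_add[symmetric] distrib_left[symmetric] Re_exp del: of_real_add flip: of_real_add)
  also have "\<dots> = Re (\<integral>u. iexp (s \<bullet> u) * iexp c \<partial>std_mvnormal)"
    by (rule integral_Re) (auto intro!: std.integrable_iexp)
  also have "\<dots> = Re (complex_of_real (exp (- (s \<bullet> s) / 2)) * iexp c)"
    by (simp only: integral_mult_left_zero std_mvnormal_char)
  also have "\<dots> = exp (- (t \<bullet> (S *v t)) / 2) * cos c"
    by (simp add: ss Re_exp)
  finally show "(\<integral>z. cos (t \<bullet> z + c) \<partial>mvnormal0 S) = exp (- (t \<bullet> (S *v t)) / 2) * cos c" .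
qed

section \<open>The posterior mean\<close>

lemma diag_mat_inverse:
  assumes "\<And>k. g $ k \<noteq> 0"
  shows "matrix_inv (diag_mat g) = diag_mat (\<chi> k. 1 / g $ k)"
proof (rule matrix_inv_unique)
  have "(\<Sum>k\<in>UNIV. (if i = k then g $ i else 0) * (if k = j then 1 / g $ k else 0)) = (if i = j then 1 else 0)" for i j
    by (subst sum.remove[of _ i]) (auto simp: assms intro!: sum.neutral)
  then show "diag_mat g ** diag_mat (\<chi> k. 1 / g $ k) = mat 1"
    by (simp add: diag_mat_def matrix_matrix_mult_def mat_def vec_eq_iff split del: if_split cong: if_cong)
qed

lemma gram_mult: "gram n x *v w = (\<Sum>i<n. (x i \<bullet> w) *\<^sub>R x i)"
proof (rule vec_eq_iff[THEN iffD2, rule_format])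
  fix j
  have "(gram n x *v w) $ j = (\<Sum>l\<in>UNIV. \<Sum>i<n. x i $ j * x i $ l * w $ l)"
    by (simp add: gram_def matrix_vector_mult_def sum_distrib_right)
  also have "\<dots> = (\<Sum>i<n. \<Sum>l\<in>UNIV. x i $ j * x i $ l * w $ l)"
    by (rule sum.swap)
  also have "\<dots> = (\<Sum>i<n. (x i \<bullet> w) *\<^sub>R x i) $ j"
    by (simp add: inner_vec_def sum_distrib_left sum_distrib_right ac_simps)
  finally show "(gram n x *v w) $ j = (\<Sum>i<n. (x i \<bullet> w) *\<^sub>R x i) $ j" .
qed

text \<open>The posterior precision: the likelihood contributes the Gram matrix divided by the noise
  variance \<open>n\<close>, the prior its inverse covariance.\<close>

definition post_prec :: "nat \<Rightarrow> (nat \<Rightarrow> real^'k) \<Rightarrow> real^'k \<Rightarrow> real^'k^'k" where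
  "post_prec n x g = (1 / real n) *\<^sub>R gram n x + matrix_inv (diag_mat g)"

lemma post_prec_inner:
  assumes "\<And>k. g $ k \<noteq> 0"
  shows "v \<bullet> (post_prec n x g *v w) =
    (\<Sum>i<n. (x i \<bullet> v) * (x i \<bullet> w) / real n) + (\<Sum>k\<in>UNIV. v $ k * w $ k / g $ k)"
proof -
  have "v \<bullet> (diag_mat (\<chi> k. 1 / g $ k) *v w) = (\<Sum>k\<in>UNIV. v $ k * w $ k / g $ k)"
    by (simp add: diag_mat_def matrix_vector_mult_def inner_vec_def if_distrib if_distribR cong: if_cong)
  then show ?thesis
    unfolding post_prec_def diag_mat_inverse[OF assms]
    by (simp add: matrix_vector_mult_add_rdistrib scaleR_matrix_vector_assoc[symmetric] gram_mult inner_add_right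
        inner_sum_right sum_divide_distrib inner_commute ac_simps)
qed

lemma transpose_post_prec:
  assumes "\<And>k. g $ k \<noteq> 0"
  shows "transpose (post_prec n x g) = post_prec n x g"
  unfolding post_prec_def diag_mat_inverse[OF assms]
  by (auto simp: transpose_def gram_def diag_mat_def vec_eq_iff mult.commute)

text \<open>The Gram part is nonnegative, so the prior alone supplies the constant, the smallest
  \<open>1 / g $ k\<close>. Being independent of \<open>n\<close> and \<open>x\<close>, it controls
  all inverse precisions at once.\<close>

lemma post_prec_coercive:
  fixes g :: "real^'k"
  assumes g: "\<And>k. g $ k > 0"
  obtains c where "c > 0" "\<And>n x v. c * (v \<bullet> v) \<le> v \<bullet> (post_prec n x g *v v)"
proof
  let ?c = "Min (range (\<lambda>k. 1 / g $ k))"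
  show "?c > 0"
    using g by (subst Min_gr_iff) auto
  have g0: "g $ k \<noteq> 0" for k using g[of k] by simp
  show "?c * (v \<bullet> v) \<le> v \<bullet> (post_prec n x g *v v)" for n x v
  proof -
    have "?c * (v \<bullet> v) = (\<Sum>k\<in>UNIV. ?c * (v $ k * v $ k))"
      by (simp add: inner_vec_def sum_distrib_left)
    also have "\<dots> \<le> (\<Sum>k\<in>UNIV. 1 / g $ k * (v $ k * v $ k))"
      by (intro sum_mono mult_right_mono Min_le) auto
    also have "\<dots> \<le> (\<Sum>i<n. (x i \<bullet> v) * (x i \<bullet> v) / real n) + (\<Sum>k\<in>UNIV. v $ k * v $ k / g $ k)"
      by (simp add: sum_nonneg)
    also have "\<dots> = v \<bullet> (post_prec n x g *v v)"
      by (rule post_prec_inner[OF g0, symmetric])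
    finally show ?thesis .
  qed
qed

lemma pos_def_post_prec:
  assumes g: "\<And>k. g $ k > 0"
  shows "pos_def_mat (post_prec n x g)"
proof -
  have "g $ k \<noteq> 0" for k using g[of k] by simp
  moreover obtain c where "c > 0" "\<And>n x v. c * (v \<bullet> v) \<le> v \<bullet> (post_prec n x g *v v)"
    using post_prec_coercive[of g] g by blast
  ultimately show ?thesis
    unfolding pos_def_mat_def
    by (metis inner_gt_zero_iff less_le_trans mult_pos_pos transpose_post_prec)
qed

section \<open>Gaussian integrals and means of symmetric weights\<close>

lemma integrable_gaussian:
  assumes "c > 0"
  shows "integrable lborel (\<lambda>v::'a::euclidean_space. exp (- c * (v \<bullet> v)))"
proof -
  have "integrable lborel (\<lambda>x::real. exp (- c * x\<^sup>2))"
  proof -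
    \<comment> \<open>The standard deviation for which
      \<open>1 / (2 * \<sigma>\<^sup>2) = c\<close>.\<close>
    define \<sigma> where "\<sigma> = 1 / sqrt (2 * c)"
    have \<sigma>: "\<sigma> > 0" "2 * \<sigma>\<^sup>2 = 1 / c"
      using assms by (simp_all add: \<sigma>_def power_divide)
    have "exp (- c * x\<^sup>2) = sqrt (2 * pi * \<sigma>\<^sup>2) * normal_density 0 \<sigma> x" for x
      using \<sigma> by (simp add: normal_density_def mult.commute)
    then show ?thesis
      using integrable_normal_density[OF \<sigma>(1), of 0] by simp
  qed
  then have "integrable lborel (\<lambda>v::'a. \<Prod>b\<in>Basis. exp (- c * (v \<bullet> b)\<^sup>2))"
    by (intro integrable_lborel_prod[where f="\<lambda>_ x. exp (- c * x\<^sup>2)"])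
  moreover have "(\<Prod>b\<in>Basis. exp (- c * (v \<bullet> b)\<^sup>2)) = exp (- c * (v \<bullet> v))" for v :: 'a
    by (subst euclidean_inner) (simp add: exp_sum[symmetric] sum_distrib_left power2_eq_square sum_negf)
  ultimately show ?thesis by simp
qed

text \<open>Half of the exponent absorbs the factor \<open>norm v\<close>, by
  \<open>2 * t \<le> 1 + t\<^sup>2 \<le> exp (t\<^sup>2)\<close>. This makes first moments
  integrable.\<close>

lemma norm_mult_gaussian_le:
  assumes "c > 0"
  shows "norm v * exp (- c * (v \<bullet> v)) \<le> 1 / sqrt (2 * c) * exp (- (c / 2) * (v \<bullet> v))"
proof -
  define t where "t = sqrt (c / 2) * norm v"
  have t: "t\<^sup>2 = c / 2 * (v \<bullet> v)"
    using assms by (simp add: t_def power_mult_distrib power2_norm_eq_inner)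
  have "sqrt (2 * c) * norm v = 2 * t"
  proof -
    have "sqrt (2 * c) = sqrt (4 * (c / 2))" by simp
    also have "\<dots> = 2 * sqrt (c / 2)" by (subst real_sqrt_mult) simp
    finally show ?thesis by (simp add: t_def)
  qed
  also have "2 * t \<le> 1 + t\<^sup>2"
    using sum_squares_bound[of 1 t] by simp
  also have "\<dots> \<le> exp (t\<^sup>2)"
    by (rule exp_ge_add_one_self)
  finally have "norm v \<le> 1 / sqrt (2 * c) * exp (c / 2 * (v \<bullet> v))"
    using assms unfolding t by (simp add: field_simps)
  then have "norm v * exp (- c * (v \<bullet> v)) \<le> 1 / sqrt (2 * c) * exp (c / 2 * (v \<bullet> v)) * exp (- c * (v \<bullet> v))"
    by (intro mult_right_mono) auto
  also have "\<dots> = 1 / sqrt (2 * c) * (exp (c / 2 * (v \<bullet> v)) * exp (- c * (v \<bullet> v)))"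
    by simp
  also have "exp (c / 2 * (v \<bullet> v)) * exp (- c * (v \<bullet> v)) = exp (- (c / 2) * (v \<bullet> v))"
    unfolding exp_add[symmetric] by (simp add: algebra_simps)
  finally show ?thesis .
qed

lemma lborel_distr_uminus_euclidean: "distr lborel borel uminus = (lborel :: 'a::euclidean_space measure)"
proof -
  have "density (distr lborel borel (\<lambda>x::'a. - x)) (\<lambda>_. 1) = distr lborel borel (\<lambda>x. - x)"
    by (rule density_1)
  then show ?thesis
    using lborel_affine[of "-1" "0::'a"] by simp
qed

text \<open>After translation by \<open>m\<close> the weight is a multiple of the even function
  \<open>h\<close>, so the integral of \<open>h v *\<^sub>R v\<close> vanishes and the constants
  cancel in the quotient. The Gaussian bound secures the integrability needed to split the
  integrals.\<close>

lemma centered_weight_mean: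
  fixes w :: "'a::euclidean_space \<Rightarrow> real" and h :: "'a \<Rightarrow> real"
  assumes w: "\<And>v. w (m + v) = C * h v" and C: "C > 0"
    and [measurable]: "h \<in> borel_measurable borel" and pos: "\<And>v. h v > 0" and even: "\<And>v. h (- v) = h v"
    and c: "c > 0" and le: "\<And>v. h v \<le> exp (- c * (v \<bullet> v))"
  shows "(1 / (\<integral>b. w b \<partial>lborel)) *\<^sub>R (\<integral>b. w b *\<^sub>R b \<partial>lborel) = m"
proof -
  have int: "integrable lborel h"
    using integrable_gaussian[OF c, where 'a='a]
    by (rule Bochner_Integration.integrable_bound) (use pos le in \<open>auto simp: less_imp_le abs_of_pos\<close>)
  have "integrable lborel (\<lambda>v::'a. 1 / sqrt (2 * c) * exp (- (c / 2) * (v \<bullet> v)))"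
    using integrable_gaussian[of "c / 2", where 'a='a] c by (intro integrable_mult_right) simp
  then have intv: "integrable lborel (\<lambda>v. h v *\<^sub>R v)"
  proof (rule Bochner_Integration.integrable_bound)
    show "AE v in lborel. norm (h v *\<^sub>R v) \<le> norm (1 / sqrt (2 * c) * exp (- (c / 2) * (v \<bullet> v)))"
    proof (rule AE_I2)
      fix v :: 'a
      have "norm (h v *\<^sub>R v) \<le> norm v * exp (- c * (v \<bullet> v))"
        using pos[of v] le[of v] by (simp add: mult.commute mult_left_mono)
      also note norm_mult_gaussian_le[OF c]
      finally show "norm (h v *\<^sub>R v) \<le> norm (1 / sqrt (2 * c) * exp (- (c / 2) * (v \<bullet> v)))"
        using c by simp
    qed
  qed simp
  have "(\<integral>v. h v *\<^sub>R v \<partial>lborel) = (\<integral>v. h (- v) *\<^sub>R (- v) \<partial>lborel)"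
    by (subst lborel_distr_uminus_euclidean[symmetric], subst integral_distr) auto
  also have "\<dots> = - (\<integral>v. h v *\<^sub>R v \<partial>lborel)"
    by (simp add: even)
  finally have "(2::real) *\<^sub>R (\<integral>v. h v *\<^sub>R v \<partial>lborel) = 0"
    unfolding eq_neg_iff_add_eq_0 scaleR_2 .
  then have zero: "(\<integral>v. h v *\<^sub>R v \<partial>lborel) = 0"
    by simp
  \<comment> \<open>A positive function with integral zero would make the whole space a null
    set.\<close>
  have ne: "(\<integral>v. h v \<partial>lborel) \<noteq> 0"
  proof
    assume "(\<integral>v. h v \<partial>lborel) = 0"
    then have "AE v in (lborel :: 'a measure). h v = 0"
      using integral_nonneg_eq_0_iff_AE[OF int] pos by (auto simp: less_imp_le)
    then have "AE v in (lborel :: 'a measure). False"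
      by (rule AE_mp) (use pos in \<open>auto intro!: AE_I2 simp: less_le\<close>)
    then show False
      using AE_iff_measurable[of UNIV "lborel :: 'a measure" "\<lambda>_. False"] by simp
  qed
  have [measurable]: "w \<in> borel_measurable borel"
  proof -
    have "w = (\<lambda>b. C * h (b - m))"
      using w[of "b - m" for b] by (simp add: fun_eq_iff)
    then show ?thesis by simp
  qed
  have "(\<integral>b. w b \<partial>lborel) = (\<integral>v. w (m + v) \<partial>lborel)"
    by (subst lborel_distr_plus[of m, symmetric], subst integral_distr) auto
  also have "\<dots> = C * (\<integral>v. h v \<partial>lborel)"
    by (simp add: w)
  finally have W: "(\<integral>b. w b \<partial>lborel) = C * (\<integral>v. h v \<partial>lborel)" .
  have "(\<integral>b. w b *\<^sub>R b \<partial>lborel) = (\<integral>v. w (m + v) *\<^sub>R (m + v) \<partial>lborel)"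
    by (subst lborel_distr_plus[of m, symmetric], subst integral_distr) auto
  also have "\<dots> = (\<integral>v. C *\<^sub>R (h v *\<^sub>R m + h v *\<^sub>R v) \<partial>lborel)"
    by (simp add: w scaleR_add_right)
  also have "\<dots> = C *\<^sub>R (\<integral>v. h v *\<^sub>R m + h v *\<^sub>R v \<partial>lborel)"
    by (rule integral_scaleR_right)
  also have "(\<integral>v. h v *\<^sub>R m + h v *\<^sub>R v \<partial>lborel) = (\<integral>v. h v \<partial>lborel) *\<^sub>R m"
    using int intv zero by (subst Bochner_Integration.integral_add) auto
  finally show ?thesis
    using C ne by (simp add: W)
qed

text \<open>Completing the square: the equation for \<open>m\<close> is the stationarity condition
  of the log posterior, so the terms linear in \<open>v\<close> cancel and only the quadratic form
  of the precision remains.\<close>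

lemma post_weight_shift:
  fixes x :: "nat \<Rightarrow> real^'k"
  assumes g: "\<And>k. g $ k > 0" and n: "n > 0"
    and m: "post_prec n x g *v m = (1 / real n) *\<^sub>R (\<Sum>i<n. y i *\<^sub>R x i)"
  shows "\<exists>C>0. \<forall>v. post_weight n x y g (m + v) = C * exp (- (v \<bullet> (post_prec n x g *v v)) / 2)"
proof -
  have g0: "g $ k \<noteq> 0" for k using g[of k] by simp
  define Q where "Q b = (\<Sum>i<n. (y i - x i \<bullet> b)\<^sup>2 / (2 * real n)) + (\<Sum>k\<in>UNIV. (b $ k)\<^sup>2 / (2 * g $ k))" for b
  define K where "K = (\<Prod>i<n. 1 / sqrt (2 * pi * real n)) * (\<Prod>k\<in>UNIV. 1 / sqrt (2 * pi * g $ k))"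
  have K: "K > 0"
    unfolding K_def using g n by (intro mult_pos_pos prod_pos) auto
  have pw: "post_weight n x y g b = K * exp (- Q b)" for b
  proof -
    have "(\<Prod>i<n. normal_density (x i \<bullet> b) (sqrt (real n)) (y i)) =
        (\<Prod>i<n. 1 / sqrt (2 * pi * real n)) * exp (\<Sum>i<n. - ((y i - x i \<bullet> b)\<^sup>2 / (2 * real n)))"
      using n by (simp only: exp_sum[OF finite_lessThan] prod.distrib[symmetric]) (simp add: normal_density_def)
    moreover have "(\<Prod>k\<in>UNIV. normal_density 0 (sqrt (g $ k)) (b $ k)) =
        (\<Prod>k\<in>UNIV. 1 / sqrt (2 * pi * g $ k)) * exp (\<Sum>k\<in>UNIV. - ((b $ k)\<^sup>2 / (2 * g $ k)))"
      using g by (simp only: exp_sum[OF finite] prod.distrib[symmetric]) (simp add: normal_density_def less_imp_le)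
    moreover have "exp (- Q b) = exp (\<Sum>i<n. - ((y i - x i \<bullet> b)\<^sup>2 / (2 * real n))) * exp (\<Sum>k\<in>UNIV. - ((b $ k)\<^sup>2 / (2 * g $ k)))"
      unfolding exp_add[symmetric] by (simp add: Q_def sum_negf)
    ultimately show ?thesis
      unfolding post_weight_def K_def by (simp only: ac_simps)
  qed
  have Q: "Q (m + v) = Q m + v \<bullet> (post_prec n x g *v v) / 2" for v
  proof -
    have "v \<bullet> (post_prec n x g *v m) = (\<Sum>i<n. y i * (x i \<bullet> v) / real n)"
      unfolding m by (simp add: inner_sum_right sum_divide_distrib inner_commute)
    \<comment> \<open>Here the choice of \<open>m\<close> enters: the cross terms of likelihood and
      prior add up to the term that comes from the data.\<close>
    then have lin: "(\<Sum>i<n. (x i \<bullet> v) * (x i \<bullet> m) / real n) + (\<Sum>k\<in>UNIV. v $ k * m $ k / g $ k)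
        = (\<Sum>i<n. y i * (x i \<bullet> v) / real n)"
      by (simp add: post_prec_inner[OF g0])
    \<comment> \<open>The bookkeeping with whole sums as atoms; \<open>c + e = d\<close> is the
      cancellation \<open>lin\<close>.\<close>
    have arith: "p = a + s / 2 + c - d \<Longrightarrow> q = b + r / 2 + e \<Longrightarrow> c + e = d \<Longrightarrow> p + q = a + b + (s + r) / 2"
      for a b c d e p q r s :: real by simp
    have "(\<Sum>i<n. (y i - x i \<bullet> (m + v))\<^sup>2 / (2 * real n)) =
        (\<Sum>i<n. (y i - x i \<bullet> m)\<^sup>2 / (2 * real n) + (x i \<bullet> v) * (x i \<bullet> v) / real n / 2
          + (x i \<bullet> v) * (x i \<bullet> m) / real n - y i * (x i \<bullet> v) / real n)"
      using n by (intro sum.cong refl) (simp add: inner_add_right field_simps power2_eq_square)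
    moreover have "(\<Sum>k\<in>UNIV. ((m + v) $ k)\<^sup>2 / (2 * g $ k)) =
        (\<Sum>k\<in>UNIV. (m $ k)\<^sup>2 / (2 * g $ k) + v $ k * v $ k / g $ k / 2 + v $ k * m $ k / g $ k)"
      using g0 by (intro sum.cong refl) (simp add: field_simps power2_eq_square)
    ultimately have "Q (m + v) = Q m + ((\<Sum>i<n. (x i \<bullet> v) * (x i \<bullet> v) / real n) + (\<Sum>k\<in>UNIV. v $ k * v $ k / g $ k)) / 2"
      using lin unfolding Q_def sum.distrib sum_subtractf sum_divide_distrib[of _ UNIV 2, symmetric]
        sum_divide_distrib[of _ "{..<n}" 2, symmetric] by (rule arith)
    then show ?thesis
      by (simp only: post_prec_inner[OF g0])
  qed
  have "post_weight n x y g (m + v) = K * exp (- Q m) * exp (- (v \<bullet> (post_prec n x g *v v)) / 2)" for v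
    by (simp add: pw Q exp_add[symmetric] exp_diff exp_minus field_simps)
  then show ?thesis
    using K by (intro exI[of _ "K * exp (- Q m)"]) simp
qed

text \<open>The weight is symmetric about the solution \<open>m\<close> of the normal equations.
  Coercivity, halved by the factor in the exponent, gives the Gaussian majorant.\<close>

lemma posterior_mean_eq:
  assumes g: "\<And>k. g $ k > 0" and n: "n > 0"
  shows "posterior_mean n x y g = matrix_inv (post_prec n x g) *v ((1 / real n) *\<^sub>R (\<Sum>i<n. y i *\<^sub>R x i))"
proof -
  define A where "A = post_prec n x g"
  define m where "m = matrix_inv A *v ((1 / real n) *\<^sub>R (\<Sum>i<n. y i *\<^sub>R x i))"
  have "A *v m = (1 / real n) *\<^sub>R (\<Sum>i<n. y i *\<^sub>R x i)"
    unfolding m_def A_def using pos_def_mat_inverse[OF pos_def_post_prec[of g n x, OF g]]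
    by (simp only: matrix_vector_mul_assoc matrix_vector_mul_lid)
  then obtain C where C: "C > 0" "\<And>v. post_weight n x y g (m + v) = C * exp (- (v \<bullet> (A *v v)) / 2)"
    unfolding A_def using post_weight_shift[of g n x m y, OF g n] by blast
  obtain c where c: "c > 0" "\<And>n x v. c * (v \<bullet> v) \<le> v \<bullet> (post_prec n x g *v v)"
    using post_prec_coercive[of g] g by blast
  have [measurable]: "(*v) A \<in> borel_measurable borel"
    by (intro borel_measurable_continuous_onI linear_continuous_on matrix_vector_mul_bounded_linear)
  show ?thesis
    unfolding posterior_mean_def m_def[symmetric, unfolded A_def]
  proof (rule centered_weight_mean[where h="\<lambda>v. exp (- (v \<bullet> (A *v v)) / 2)", OF C(2,1)])
    show "c / 2 > 0" using c by simp
    show "exp (- (v \<bullet> (A *v v)) / 2) \<le> exp (- (c / 2) * (v \<bullet> v))" for v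
      using c(2)[of v n x] by (simp add: A_def)
  qed (auto simp: linear_neg matrix_vector_mul_linear)
qed

section \<open>Triangular arrays\<close>

text \<open>The upper bound is \<open>exp (- y) \<le> 1 / (1 + y)\<close> together with
  \<open>(1 - y + y\<^sup>2) * (1 + y) = 1 + y ^ 3\<close>.\<close>

lemma exp_minus_approx:
  fixes y :: real
  assumes "y \<ge> 0"
  shows "\<bar>exp (- y) - (1 - y)\<bar> \<le> y\<^sup>2"
proof -
  have "1 + y \<le> exp y"
    by (rule exp_ge_add_one_self)
  then have "exp (- y) \<le> 1 / (1 + y)"
    using assms by (simp add: exp_minus field_simps)
  also have "1 / (1 + y) \<le> 1 - y + y\<^sup>2"
  proof -
    have "1 \<le> (1 - y + y\<^sup>2) * (1 + y)"
      using assms by (simp add: algebra_simps power2_eq_square)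
    then show ?thesis
      using assms by (simp add: divide_le_eq)
  qed
  finally show ?thesis
    using exp_ge_add_one_self[of "- y"] by simp
qed

section \<open>Characteristic functions and second moments of weighted sums\<close>

context prob_space
begin

text \<open>A third-order Taylor error, with the third absolute moment absorbed by
  \<open>\<bar>z\<bar> ^ 3 \<le> 1 + z ^ 4\<close>; passing from \<open>1 - t\<^sup>2 / 2\<close> to
  the exponential costs at most \<open>t ^ 4\<close>. The constants are crude, since only the order
  in \<open>t\<close> matters.\<close>

lemma char_approx_fourth_moment:
  assumes X: "random_variable borel X" "integrable M X" "integrable M (\<lambda>\<omega>. (X \<omega>)\<^sup>2)"
      "integrable M (\<lambda>\<omega>. (X \<omega>) ^ 4)"
    and mom: "expectation X = 0" "expectation (\<lambda>\<omega>. (X \<omega>)\<^sup>2) = 1" "expectation (\<lambda>\<omega>. (X \<omega>) ^ 4) \<le> K"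
  shows "cmod (char (distr M borel X) t - complex_of_real (exp (- t\<^sup>2 / 2))) \<le> (\<bar>t\<bar> * (1 + K) + t\<^sup>2) * t\<^sup>2"
proof -
  note X(1)[measurable]
  have var: "variance X = 1"
    using mom by simp
  have cube: "\<bar>z\<bar> ^ 3 \<le> 1 + z ^ 4" for z :: real
  proof (cases "\<bar>z\<bar> \<le> 1")
    case True
    then have "\<bar>z\<bar> ^ 3 \<le> 1" by (simp add: power_le_one)
    moreover have "0 \<le> z ^ 4" by simp
    ultimately show ?thesis by linarith
  next
    case False
    then have "\<bar>z\<bar> ^ 3 \<le> \<bar>z\<bar> ^ 4" by (intro power_increasing) auto
    then show ?thesis by simp
  qed
  have int4: "integrable M (\<lambda>\<omega>. \<bar>t\<bar> * (1 + (X \<omega>) ^ 4))"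
    using X(4) by simp
  have bound: "min (6 * (X \<omega>)\<^sup>2) (\<bar>t\<bar> * \<bar>X \<omega>\<bar> ^ 3) \<le> \<bar>t\<bar> * (1 + (X \<omega>) ^ 4)" for \<omega>
    using mult_left_mono[OF cube[of "X \<omega>"], of "\<bar>t\<bar>"] by linarith
  have "integrable M (\<lambda>\<omega>. min (6 * (X \<omega>)\<^sup>2) (\<bar>t\<bar> * \<bar>X \<omega>\<bar> ^ 3))"
    by (rule Bochner_Integration.integrable_bound[OF int4]) (use bound in \<open>auto simp: abs_of_nonneg\<close>)
  then have "expectation (\<lambda>\<omega>. min (6 * (X \<omega>)\<^sup>2) (\<bar>t\<bar> * \<bar>X \<omega>\<bar> ^ 3)) \<le> expectation (\<lambda>\<omega>. \<bar>t\<bar> * (1 + (X \<omega>) ^ 4))"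
    using int4 bound by (intro integral_mono) auto
  also have "\<dots> = \<bar>t\<bar> * (1 + expectation (\<lambda>\<omega>. (X \<omega>) ^ 4))"
    using X(4) prob_space by simp
  also have "\<dots> \<le> \<bar>t\<bar> * (1 + K)"
    using mom(3) by (intro mult_left_mono) auto
  finally have E: "expectation (\<lambda>\<omega>. min (6 * (X \<omega>)\<^sup>2) (\<bar>t\<bar> * \<bar>X \<omega>\<bar> ^ 3)) \<le> \<bar>t\<bar> * (1 + K)" .
  have "cmod (char (distr M borel X) t - complex_of_real (1 - t\<^sup>2 / 2)) \<le>
      t\<^sup>2 / 6 * expectation (\<lambda>\<omega>. min (6 * (X \<omega>)\<^sup>2) (\<bar>t\<bar> * \<bar>X \<omega>\<bar> ^ 3))"
    using char_approx3'[OF X(1-3) mom(1) var refl, of t] by simp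
  also have "\<dots> \<le> t\<^sup>2 / 6 * (\<bar>t\<bar> * (1 + K))"
    using E by (intro mult_left_mono) auto
  also have "\<dots> \<le> t\<^sup>2 * (\<bar>t\<bar> * (1 + K))"
  proof -
    have "0 \<le> expectation (\<lambda>\<omega>. (X \<omega>) ^ 4)" by simp
    with mom(3) have "0 \<le> \<bar>t\<bar> * (1 + K)" by (intro mult_nonneg_nonneg) linarith+
    then show ?thesis by (intro mult_right_mono) auto
  qed
  finally have 1: "cmod (char (distr M borel X) t - complex_of_real (1 - t\<^sup>2 / 2)) \<le> t\<^sup>2 * (\<bar>t\<bar> * (1 + K))" .
  have "cmod (complex_of_real (1 - t\<^sup>2 / 2) - complex_of_real (exp (- t\<^sup>2 / 2))) = \<bar>exp (- (t\<^sup>2 / 2)) - (1 - t\<^sup>2 / 2)\<bar>"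
    unfolding of_real_diff[symmetric] norm_of_real by simp
  also have "\<dots> \<le> (t\<^sup>2 / 2)\<^sup>2"
    by (rule exp_minus_approx) simp
  also have "\<dots> \<le> t\<^sup>2 * t\<^sup>2"
    unfolding power2_eq_square[of "t\<^sup>2 / 2"] by (intro mult_mono) auto
  finally have 2: "cmod (complex_of_real (1 - t\<^sup>2 / 2) - complex_of_real (exp (- t\<^sup>2 / 2))) \<le> t\<^sup>2 * t\<^sup>2" .
  show ?thesis
    using norm_triangle_mono[OF 1 2] by (simp add: algebra_simps)
qed

text \<open>Lyapunov's argument: for factors of modulus at most 1, a difference of products is at
  most the sum of the differences, and pulling out the bound \<open>b\<close> on the weights leaves
  the variance of the sum.\<close>

lemma char_weighted_sum_approx:
  fixes X :: "nat \<Rightarrow> 'a \<Rightarrow> real"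
  assumes indep: "indep_vars (\<lambda>_. borel) X {..<n}"
    and int: "\<And>i. i < n \<Longrightarrow> integrable M (X i)" "\<And>i. i < n \<Longrightarrow> integrable M (\<lambda>\<omega>. (X i \<omega>)\<^sup>2)"
      "\<And>i. i < n \<Longrightarrow> integrable M (\<lambda>\<omega>. (X i \<omega>) ^ 4)"
    and mom: "\<And>i. i < n \<Longrightarrow> expectation (X i) = 0" "\<And>i. i < n \<Longrightarrow> expectation (\<lambda>\<omega>. (X i \<omega>)\<^sup>2) = 1"
      "\<And>i. i < n \<Longrightarrow> expectation (\<lambda>\<omega>. (X i \<omega>) ^ 4) \<le> K"
    and b: "\<And>i. i < n \<Longrightarrow> \<bar>a i\<bar> \<le> b" and K: "K \<ge> 0"
  shows "cmod ((\<integral>\<omega>. iexp (\<Sum>i<n. a i * X i \<omega>) \<partial>M) - complex_of_real (exp (- (\<Sum>i<n. (a i)\<^sup>2) / 2)))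
    \<le> (b * (1 + K) + b\<^sup>2) * (\<Sum>i<n. (a i)\<^sup>2)"
proof -
  have rv [measurable]: "random_variable borel (X i)" if "i < n" for i
    using indep that by (auto simp: indep_vars_def)
  define \<phi> where "\<phi> i = char (distr M borel (X i)) (a i)" for i
  have "(\<integral>\<omega>. iexp (\<Sum>i<n. a i * X i \<omega>) \<partial>M) = char (distr M borel (\<lambda>\<omega>. \<Sum>i<n. a i * X i \<omega>)) 1"
    unfolding char_def by (subst integral_distr) auto
  also have "\<dots> = (\<Prod>i<n. char (distr M borel (\<lambda>\<omega>. a i * X i \<omega>)) 1)"
    by (intro char_distr_sum indep_vars_compose2[OF indep]) simp
  also have "\<dots> = (\<Prod>i<n. \<phi> i)"
    unfolding \<phi>_def char_def by (intro prod.cong refl, subst (1 2) integral_distr) auto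
  finally have 1: "(\<integral>\<omega>. iexp (\<Sum>i<n. a i * X i \<omega>) \<partial>M) = (\<Prod>i<n. \<phi> i)" .
  have 2: "complex_of_real (exp (- (\<Sum>i<n. (a i)\<^sup>2) / 2)) = (\<Prod>i<n. complex_of_real (exp (- (a i)\<^sup>2 / 2)))"
    unfolding of_real_prod[symmetric] exp_sum[OF finite_lessThan, symmetric]
    by (simp add: sum_negf sum_divide_distrib)
  have "cmod ((\<Prod>i<n. \<phi> i) - (\<Prod>i<n. complex_of_real (exp (- (a i)\<^sup>2 / 2))))
      \<le> (\<Sum>i<n. cmod (\<phi> i - complex_of_real (exp (- (a i)\<^sup>2 / 2))))"
  proof (rule norm_prod_diff)
    show "cmod (\<phi> i) \<le> 1" if "i \<in> {..<n}" for i
      unfolding \<phi>_def using that by (intro real_distribution.cmod_char_le_1 real_distribution_distr) auto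
  qed simp
  also have "\<dots> \<le> (\<Sum>i<n. (b * (1 + K) + b\<^sup>2) * (a i)\<^sup>2)"
  proof (rule sum_mono)
    fix i assume i: "i \<in> {..<n}"
    then have "cmod (\<phi> i - complex_of_real (exp (- (a i)\<^sup>2 / 2))) \<le> (\<bar>a i\<bar> * (1 + K) + (a i)\<^sup>2) * (a i)\<^sup>2"
      unfolding \<phi>_def using int mom by (intro char_approx_fourth_moment) auto
    also have "\<dots> \<le> (b * (1 + K) + b\<^sup>2) * (a i)\<^sup>2"
      using b[of i] i K power_mono[of "\<bar>a i\<bar>" b 2] by (intro mult_right_mono add_mono) auto
    finally show "cmod (\<phi> i - complex_of_real (exp (- (a i)\<^sup>2 / 2))) \<le> (b * (1 + K) + b\<^sup>2) * (a i)\<^sup>2" .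
  qed
  finally show ?thesis
    unfolding 1 2 sum_distrib_left .
qed

text \<open>Independent centred variables are orthogonal, so only the diagonal terms of the double
  sum survive.\<close>

lemma
  fixes X :: "nat \<Rightarrow> 'a \<Rightarrow> real" and u :: "nat \<Rightarrow> 'b::euclidean_space"
  assumes indep: "indep_vars (\<lambda>_. borel) X {..<n}"
    and int: "\<And>i. i < n \<Longrightarrow> integrable M (X i)" "\<And>i. i < n \<Longrightarrow> integrable M (\<lambda>\<omega>. (X i \<omega>)\<^sup>2)"
    and mom: "\<And>i. i < n \<Longrightarrow> expectation (X i) = 0" "\<And>i. i < n \<Longrightarrow> expectation (\<lambda>\<omega>. (X i \<omega>)\<^sup>2) = 1"
  shows integrable_norm2_weighted_sum: "integrable M (\<lambda>\<omega>. (norm (\<Sum>i<n. X i \<omega> *\<^sub>R u i))\<^sup>2)"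
    and expectation_norm2_weighted_sum:
      "expectation (\<lambda>\<omega>. (norm (\<Sum>i<n. X i \<omega> *\<^sub>R u i))\<^sup>2) = (\<Sum>i<n. (norm (u i))\<^sup>2)"
proof -
  have prod: "integrable M (\<lambda>\<omega>. X i \<omega> * X j \<omega>) \<and> expectation (\<lambda>\<omega>. X i \<omega> * X j \<omega>) = (if i = j then 1 else 0)"
    if ij: "i < n" "j < n" for i j
  proof (cases "i = j")
    case True
    then show ?thesis using int(2)[of i] mom(2)[of i] ij by (simp add: power2_eq_square)
  next
    case False
    have "indep_vars (\<lambda>_. borel) X {i, j}"
      using indep by (rule indep_vars_subset) (use ij in auto)
    then have "integrable M (\<lambda>\<omega>. \<Prod>k\<in>{i, j}. X k \<omega>)"
      "expectation (\<lambda>\<omega>. \<Prod>k\<in>{i, j}. X k \<omega>) = (\<Prod>k\<in>{i, j}. expectation (X k))"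
      using int(1) ij by (auto intro!: indep_vars_integrable indep_vars_lebesgue_integral)
    then show ?thesis
      using False mom(1) ij by simp
  qed
  have eq: "(norm (\<Sum>i<n. X i \<omega> *\<^sub>R u i))\<^sup>2 = (\<Sum>i<n. \<Sum>j<n. X i \<omega> * X j \<omega> * (u i \<bullet> u j))" for \<omega>
    unfolding power2_norm_eq_inner inner_sum_left inner_sum_right 
    by (intro sum.cong refl) (simp add: inner_commute ac_simps)
  show "integrable M (\<lambda>\<omega>. (norm (\<Sum>i<n. X i \<omega> *\<^sub>R u i))\<^sup>2)"
    unfolding eq using prod by (intro Bochner_Integration.integrable_sum integrable_mult_left) auto
  have "expectation (\<lambda>\<omega>. (norm (\<Sum>i<n. X i \<omega> *\<^sub>R u i))\<^sup>2) =
      (\<Sum>i<n. \<Sum>j<n. expectation (\<lambda>\<omega>. X i \<omega> * X j \<omega>) * (u i \<bullet> u j))"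
    unfolding eq using prod
    by (subst Bochner_Integration.integral_sum,
        (intro Bochner_Integration.integrable_sum integrable_mult_left; auto),
        intro sum.cong refl, subst Bochner_Integration.integral_sum,
        (intro integrable_mult_left; auto), simp)
  also have "\<dots> = (\<Sum>i<n. \<Sum>j<n. if i = j then u i \<bullet> u i else 0)"
    using prod by (intro sum.cong refl) auto
  also have "\<dots> = (\<Sum>i<n. (norm (u i))\<^sup>2)"
    by (simp add: power2_norm_eq_inner)
  finally show "expectation (\<lambda>\<omega>. (norm (\<Sum>i<n. X i \<omega> *\<^sub>R u i))\<^sup>2) = (\<Sum>i<n. (norm (u i))\<^sup>2)" .
qed

end

text \<open>Vanishing weights against a convergent variance send the Lyapunov error to 0. The
  deterministic drift \<open>d n\<close> stays inside the cosine as a phase and becomes a factor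
  \<open>iexp (d n)\<close>.\<close>

lemma triangular_array_cos_tendsto:
  fixes eps :: "nat \<Rightarrow> nat \<Rightarrow> 'a \<Rightarrow> real" and a :: "nat \<Rightarrow> nat \<Rightarrow> real"
  assumes prob: "\<And>n. prob_space (Ms n)"
    and indep: "\<And>n. prob_space.indep_vars (Ms n) (\<lambda>_. borel) (eps n) {..<n}"
    and int1: "\<And>n i. i < n \<Longrightarrow> integrable (Ms n) (eps n i)"
    and int2: "\<And>n i. i < n \<Longrightarrow> integrable (Ms n) (\<lambda>\<omega>. (eps n i \<omega>)\<^sup>2)"
    and int4: "\<And>n i. i < n \<Longrightarrow> integrable (Ms n) (\<lambda>\<omega>. (eps n i \<omega>)^4)"
    and mean0: "\<And>n i. i < n \<Longrightarrow> (\<integral>\<omega>. eps n i \<omega> \<partial>Ms n) = 0"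
    and var1: "\<And>n i. i < n \<Longrightarrow> (\<integral>\<omega>. (eps n i \<omega>)\<^sup>2 \<partial>Ms n) = 1"
    and mom4: "\<And>n i. i < n \<Longrightarrow> (\<integral>\<omega>. (eps n i \<omega>)^4 \<partial>Ms n) \<le> M"
    and sq: "(\<lambda>n. \<Sum>i<n. (a n i)\<^sup>2) \<longlonglongrightarrow> q"
    and b: "\<And>n i. i < n \<Longrightarrow> \<bar>a n i\<bar> \<le> b n" "b \<longlonglongrightarrow> 0"
    and d: "d \<longlonglongrightarrow> d0"
  shows "(\<lambda>n. \<integral>\<omega>. cos ((\<Sum>i<n. a n i * eps n i \<omega>) + d n) \<partial>Ms n) \<longlonglongrightarrow> exp (- q / 2) * cos d0"
proof -
  define \<psi> where "\<psi> n = (\<integral>\<omega>. iexp (\<Sum>i<n. a n i * eps n i \<omega>) \<partial>Ms n)" for n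
  \<comment> \<open>The estimate for weighted sums asks for a nonnegative moment bound, which is not
    part of the assumptions on \<open>M\<close>.\<close>
  define K where "K = max M 0"
  have "cmod (\<psi> n - complex_of_real (exp (- (\<Sum>i<n. (a n i)\<^sup>2) / 2)))
      \<le> (b n * (1 + K) + (b n)\<^sup>2) * (\<Sum>i<n. (a n i)\<^sup>2)" for n
  proof -
    interpret prob_space "Ms n" by (rule prob)
    show ?thesis
      unfolding \<psi>_def
      using indep int1 int2 int4 mean0 var1 mom4 b(1) unfolding K_def
      by (intro char_weighted_sum_approx) (auto simp: le_max_iff_disj)
  qed
  moreover have "(\<lambda>n. (b n * (1 + K) + (b n)\<^sup>2) * (\<Sum>i<n. (a n i)\<^sup>2)) \<longlonglongrightarrow> 0"
    by (rule tendsto_eq_intros sq b refl | simp)+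
  ultimately have "(\<lambda>n. \<psi> n - complex_of_real (exp (- (\<Sum>i<n. (a n i)\<^sup>2) / 2))) \<longlonglongrightarrow> 0"
    by (rule Lim_null_comparison[OF always_eventually, OF allI])
  moreover have "(\<lambda>n. complex_of_real (exp (- (\<Sum>i<n. (a n i)\<^sup>2) / 2))) \<longlonglongrightarrow> complex_of_real (exp (- q / 2))"
    by (intro tendsto_intros sq) simp
  ultimately have "\<psi> \<longlonglongrightarrow> complex_of_real (exp (- q / 2))"
    using tendsto_add by fastforce
  then have "(\<lambda>n. Re (\<psi> n * iexp (d n))) \<longlonglongrightarrow> Re (complex_of_real (exp (- q / 2)) * iexp d0)"
    by (intro tendsto_intros d)
  moreover have "Re (complex_of_real (exp (- q / 2)) * iexp d0) = exp (- q / 2) * cos d0"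
    by (simp add: Re_exp)
  moreover have "Re (\<psi> n * iexp (d n)) = (\<integral>\<omega>. cos ((\<Sum>i<n. a n i * eps n i \<omega>) + d n) \<partial>Ms n)" for n
  proof -
    interpret prob_space "Ms n" by (rule prob)
    have [measurable]: "i < n \<Longrightarrow> eps n i \<in> borel_measurable (Ms n)" for i
      using indep[of n] by (auto simp: indep_vars_def)
    have "Re (\<psi> n * iexp (d n)) = Re (\<integral>\<omega>. iexp (\<Sum>i<n. a n i * eps n i \<omega>) * iexp (d n) \<partial>Ms n)"
      unfolding \<psi>_def by (simp only: integral_mult_left_zero)
    also have "\<dots> = (\<integral>\<omega>. Re (iexp (\<Sum>i<n. a n i * eps n i \<omega>) * iexp (d n)) \<partial>Ms n)"
      by (rule integral_Re[symmetric]) (auto intro!: integrable_iexp integrable_mult_left)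
    also have "\<dots> = (\<integral>\<omega>. cos ((\<Sum>i<n. a n i * eps n i \<omega>) + d n) \<partial>Ms n)"
      by (simp add: exp_add[symmetric] distrib_left[symmetric] Re_exp del: of_real_add of_real_sum flip: of_real_add)
    finally show ?thesis .
  qed
  ultimately show ?thesis by simp
qed

section \<open>Asymptotic law of the posterior mean\<close>

lemma tendsto_matrix_vector_mult:
  fixes A :: "'c \<Rightarrow> real^'n^'m"
  assumes "(A \<longlongrightarrow> A0) F" "(v \<longlongrightarrow> v0) F"
  shows "((\<lambda>x. A x *v v x) \<longlongrightarrow> A0 *v v0) F"
  unfolding matrix_vector_mult_def
  by (intro tendsto_vec_lambda tendsto_sum tendsto_mult tendsto_vec_nth assms)

lemma coercive_norm_le:
  fixes A :: "real^'n^'n"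
  assumes "c * (v \<bullet> v) \<le> v \<bullet> (A *v v)"
  shows "c * norm v \<le> norm (A *v v)"
proof (cases "v = 0")
  case False
  have "c * norm v * norm v \<le> norm v * norm (A *v v)"
    using assms norm_cauchy_schwarz[of v "A *v v"] by (simp add: power2_norm_eq_inner[symmetric] power2_eq_square)
  then show ?thesis using False by (simp add: mult.commute)
qed simp

lemma inner_matrix_inv_pos_def:
  assumes "pos_def_mat A"
  shows "t \<bullet> (matrix_inv A *v w) = (matrix_inv A *v t) \<bullet> w"
proof -
  have A: "A *v (matrix_inv A *v z) = z" for z
    by (simp only: matrix_vector_mul_assoc pos_def_mat_inverse[OF assms] matrix_vector_mul_lid)
  have "(A *v (matrix_inv A *v t)) \<bullet> (matrix_inv A *v w) = (matrix_inv A *v t) \<bullet> (A *v (matrix_inv A *v w))"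
    by (rule pos_def_mat_symmetric[OF assms])
  then show ?thesis by (simp only: A)
qed

text \<open>\<open>A n\<close> maps the error \<open>matrix_inv (A n) *v t - s\<close>, with
  \<open>s\<close> the limit, to \<open>t - A n *v s\<close>, which tends to 0; uniform coercivity
  allows division by \<open>c\<close>.\<close>

lemma tendsto_matrix_inv_mult:
  fixes A :: "nat \<Rightarrow> real^'n^'n"
  assumes A: "A \<longlonglongrightarrow> A0" "pos_def_mat A0" "\<And>n. pos_def_mat (A n)"
    and c: "c > 0" "\<And>n v. c * (v \<bullet> v) \<le> v \<bullet> (A n *v v)"
  shows "(\<lambda>n. matrix_inv (A n) *v t) \<longlonglongrightarrow> matrix_inv A0 *v t"
proof -
  define s where "s = matrix_inv A0 *v t"
  have inv: "B *v (matrix_inv B *v z) = z" if "pos_def_mat B" for z and B :: "real^'n^'n"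
    by (simp only: matrix_vector_mul_assoc pos_def_mat_inverse[OF that] matrix_vector_mul_lid)
  have "norm (matrix_inv (A n) *v t - s) \<le> norm (t - A n *v s) / c" for n
  proof -
    have "A n *v (matrix_inv (A n) *v t - s) = t - A n *v s"
      using inv[OF A(3)] by (simp add: matrix_vector_mult_diff_distrib)
    then have "c * norm (matrix_inv (A n) *v t - s) \<le> norm (t - A n *v s)"
      using coercive_norm_le[OF c(2)[of "matrix_inv (A n) *v t - s" n]] by simp
    then show ?thesis using c(1) by (simp add: field_simps)
  qed
  moreover have "(\<lambda>n. norm (t - A n *v s) / c) \<longlonglongrightarrow> norm (t - A0 *v s) / c"
    by (intro tendsto_intros tendsto_matrix_vector_mult A) (use c in auto)
  then have "(\<lambda>n. norm (t - A n *v s) / c) \<longlonglongrightarrow> 0"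
    using inv[OF A(2)] by (simp add: s_def)
  ultimately have "(\<lambda>n. matrix_inv (A n) *v t - s) \<longlonglongrightarrow> 0"
    by (rule Lim_null_comparison[OF always_eventually, OF allI])
  then show ?thesis
    unfolding s_def by (rule Lim_null[THEN iffD2])
qed

lemma pos_def_mat_add_inverse_diag:
  assumes S: "pos_def_mat S" and g: "\<And>k. g $ k > 0"
  shows "pos_def_mat (S + matrix_inv (diag_mat g))"
proof -
  have g0: "g $ k \<noteq> 0" for k using g[of k] by simp
  have "transpose (S + diag_mat (\<chi> k. 1 / g $ k)) = S + diag_mat (\<chi> k. 1 / g $ k)"
    using S by (auto simp: pos_def_mat_def transpose_def vec_eq_iff diag_mat_def)
  moreover have "0 \<le> v \<bullet> (matrix_inv (diag_mat g) *v v)" for v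
  proof -
    \<comment> \<open>For \<open>n = 0\<close> the Gram part is zero, so \<open>post_prec\<close> is
      the bare prior precision and its quadratic form is already known.\<close>
    have "v \<bullet> (matrix_inv (diag_mat g) *v v) = v \<bullet> (post_prec 0 (\<lambda>_. 0) g *v v)"
      by (simp add: post_prec_def)
    also have "\<dots> = (\<Sum>k\<in>UNIV. v $ k * v $ k / g $ k)"
      by (subst post_prec_inner[OF g0]) simp
    also have "\<dots> \<ge> 0"
      using g by (intro sum_nonneg divide_nonneg_pos) auto
    finally show ?thesis .
  qed
  ultimately show ?thesis
    using S unfolding pos_def_mat_def diag_mat_inverse[OF g0]
    by (auto simp: matrix_vector_mult_add_rdistrib inner_add_right intro!: add_pos_nonneg)
qed

text \<open>Dividing the observations by \<open>n\<close> turns the noise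
  \<open>sqrt (real n) * e i\<close> into \<open>e i / sqrt (real n)\<close>, the central limit
  scaling, while the factors \<open>sqrt (real n)\<close> of the signal cancel.\<close>

lemma posterior_mean_gaussian_data:
  assumes g: "\<And>k. g $ k > 0" and n: "n > 0"
  shows "posterior_mean n x (\<lambda>i. sqrt (real n) * ((x i \<bullet> b) / sqrt (real n) + e i)) g =
    matrix_inv (post_prec n x g) *v (((1 / real n) *\<^sub>R gram n x) *v b + (\<Sum>i<n. e i *\<^sub>R ((1 / sqrt (real n)) *\<^sub>R x i)))"
proof -
  have *: "(1 / real n) * (sqrt (real n) * ((x i \<bullet> b) / sqrt (real n) + e i)) = (1 / real n) * (x i \<bullet> b) + e i * (1 / sqrt (real n))" for i
    using n by (simp add: field_simps)
  show ?thesis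
    unfolding posterior_mean_eq[OF g n]
    by (simp only: scaleR_sum_right scaleR_scaleR * scaleR_add_left sum.distrib gram_mult
        scaleR_matrix_vector_assoc[symmetric])
qed

theorem theorem4:
  fixes x :: "nat \<Rightarrow> nat \<Rightarrow> real^'k"
    and beta0 gamma0 :: "real^'k"
    and Sigma0 :: "real^'k^'k"
    and Ms :: "nat \<Rightarrow> 'a measure"
    and eps :: "nat \<Rightarrow> nat \<Rightarrow> 'a \<Rightarrow> real"
    and M :: real
  assumes centered: "\<forall>\<^sub>F n in sequentially. \<forall>k. (\<Sum>i<n. x n i $ k) = 0"
    and scaled: "\<forall>\<^sub>F n in sequentially. \<forall>k. (\<Sum>i<n. (x n i $ k)^2) = real n"
    and max_norm: "(\<lambda>n. Max ((\<lambda>i. norm (x n i)) ` {..<n}) / sqrt (real n)) \<longlonglongrightarrow> 0"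
    and gram_pd: "\<forall>\<^sub>F n in sequentially. pos_def_mat (gram n (x n))"
    and gram_lim: "(\<lambda>n. (1 / real n) *\<^sub>R gram n (x n)) \<longlonglongrightarrow> Sigma0"
    and Sigma0_pd: "pos_def_mat Sigma0"
    and prob: "\<And>n. prob_space (Ms n)"
    and indep: "\<And>n. prob_space.indep_vars (Ms n) (\<lambda>_. borel) (eps n) {..<n}"
    and int1: "\<And>n i. i < n \<Longrightarrow> integrable (Ms n) (eps n i)"
    and int2: "\<And>n i. i < n \<Longrightarrow> integrable (Ms n) (\<lambda>\<omega>. (eps n i \<omega>)^2)"
    and int4: "\<And>n i. i < n \<Longrightarrow> integrable (Ms n) (\<lambda>\<omega>. (eps n i \<omega>)^4)"
    and mean0: "\<And>n i. i < n \<Longrightarrow> (\<integral>\<omega>. eps n i \<omega> \<partial>Ms n) = 0"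
    and var1: "\<And>n i. i < n \<Longrightarrow> (\<integral>\<omega>. (eps n i \<omega>)^2 \<partial>Ms n) = 1"
    and mom4: "\<And>n i. i < n \<Longrightarrow> (\<integral>\<omega>. (eps n i \<omega>)^4 \<partial>Ms n) \<le> M"
    and gamma_pos: "\<forall>k. gamma0 $ k > 0"
  shows "conv_in_distr Ms
           (\<lambda>n \<omega>. posterior_mean n (x n)
               (\<lambda>i. sqrt (real n) * ((x n i \<bullet> beta0) / sqrt (real n) + eps n i \<omega>)) gamma0)
           (distr (mvnormal0 Sigma0) borel
               (\<lambda>z. matrix_inv (Sigma0 + matrix_inv (diag_mat gamma0)) *v (Sigma0 *v beta0 + z)))"
proof -
  have g: "gamma0 $ k > 0" for k
    using gamma_pos by simp
  define S where "S n = (1 / real n) *\<^sub>R gram n (x n)" for n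
  define A where "A n = post_prec n (x n) gamma0" for n
  define A0 where "A0 = Sigma0 + matrix_inv (diag_mat gamma0)"
  define r where "r n = S n *v beta0" for n
  define u where "u n i = (1 / sqrt (real n)) *\<^sub>R x n i" for n i
  \<comment> \<open>The closed form of the posterior mean; the two agree for \<open>n > 0\<close>,
    which is all that a limit sees.\<close>
  define X where "X n \<omega> = matrix_inv (A n) *v (r n + (\<Sum>i<n. eps n i \<omega> *\<^sub>R u n i))" for n \<omega>
  define L where "L = distr (mvnormal0 Sigma0) borel (\<lambda>z. matrix_inv A0 *v (Sigma0 *v beta0 + z))"
  have S: "S \<longlonglongrightarrow> Sigma0"
    using gram_lim by (simp add: S_def[abs_def])
  have A: "A \<longlonglongrightarrow> A0" "pos_def_mat A0" "\<And>n. pos_def_mat (A n)"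
    using S Sigma0_pd g unfolding A_def[abs_def] A0_def post_prec_def S_def[abs_def]
    by (auto intro!: tendsto_intros pos_def_mat_add_inverse_diag pos_def_post_prec[unfolded post_prec_def])
  obtain c where c: "c > 0" "\<And>n v. c * (v \<bullet> v) \<le> v \<bullet> (A n *v v)"
    using post_prec_coercive[of gamma0] g unfolding A_def by metis
  have r: "r \<longlonglongrightarrow> Sigma0 *v beta0"
    unfolding r_def[abs_def] by (intro tendsto_matrix_vector_mult S tendsto_const)
  obtain R where R: "\<And>n. norm (r n) \<le> R"
    using convergent_imp_Bseq[OF convergentI[OF r]] unfolding Bseq_def by auto
  have eps_meas: "eps n i \<in> borel_measurable (Ms n)" if "i < n" for n i
    using int1[OF that] by simp
  have mult_meas [measurable]: "(*v) B \<in> borel_measurable borel" for B :: "real^'k^'k"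
    by (intro borel_measurable_continuous_onI linear_continuous_on matrix_vector_mul_bounded_linear)
  have X_meas: "X n \<in> borel_measurable (Ms n)" for n
    unfolding X_def using eps_meas by measurable
  have mv_sets [measurable_cong]: "sets (mvnormal0 Sigma0) = sets borel"
    by (simp add: mvnormal0_def)
  have conv: "conv_in_distr Ms X L"
  proof (rule conv_in_distrI_cos)
    show "prob_space L"
      unfolding L_def by (intro prob_space.prob_space_distr prob_space_mvnormal0 Sigma0_pd) measurable
    fix t :: "real^'k" and d :: real
    define s where "s n = matrix_inv (A n) *v t" for n
    define s0 where "s0 = matrix_inv A0 *v t"
    have s: "s \<longlonglongrightarrow> s0"
      unfolding s_def s0_def by (rule tendsto_matrix_inv_mult[OF A c])
    \<comment> \<open>Symmetry moves \<open>matrix_inv (A n)\<close> onto \<open>t\<close>: the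
      random part becomes a weighted sum of the errors, the rest a phase.\<close>
    have tX: "t \<bullet> X n \<omega> + d = (\<Sum>i<n. (s n \<bullet> u n i) * eps n i \<omega>) + (s n \<bullet> r n + d)" for n \<omega>
      unfolding X_def inner_matrix_inv_pos_def[OF A(3)] s_def[symmetric]
      by (simp add: inner_add_right inner_sum_right mult.commute)
    \<comment> \<open>The variance of the weighted sum is a quadratic form in \<open>S n\<close>, so
      its limit comes from \<open>gram_lim\<close>.\<close>
    have "(\<Sum>i<n. (s n \<bullet> u n i)\<^sup>2) = s n \<bullet> (S n *v s n)" for n
    proof -
      have "(s n \<bullet> u n i)\<^sup>2 = (1 / real n) * ((x n i \<bullet> s n) * (s n \<bullet> x n i))" for i
        by (simp add: u_def power2_eq_square inner_commute)
      then show ?thesis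
        unfolding S_def scaleR_matrix_vector_assoc[symmetric] gram_mult
        by (simp add: inner_sum_right sum_divide_distrib)
    qed
    then have sq: "(\<lambda>n. \<Sum>i<n. (s n \<bullet> u n i)\<^sup>2) \<longlonglongrightarrow> s0 \<bullet> (Sigma0 *v s0)"
      using tendsto_inner[OF s tendsto_matrix_vector_mult[OF S s]] by simp
    \<comment> \<open>Cauchy-Schwarz bounds the weights by the convergent \<open>norm (s n)\<close>
      times the ratio that vanishes by \<open>max_norm\<close>.\<close>
    define b where "b n = norm (s n) * (Max ((\<lambda>i. norm (x n i)) ` {..<n}) / sqrt (real n))" for n
    have b0: "b \<longlonglongrightarrow> 0"
      unfolding b_def[abs_def] using tendsto_mult[OF tendsto_norm[OF s] max_norm] by simp
    have b: "\<bar>s n \<bullet> u n i\<bar> \<le> b n" if "i < n" for n i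
    proof -
      have "\<bar>s n \<bullet> u n i\<bar> \<le> norm (s n) * norm (u n i)"
        by (rule Cauchy_Schwarz_ineq2)
      also have "norm (u n i) = norm (x n i) / sqrt (real n)"
        by (simp add: u_def)
      also have "\<dots> \<le> Max ((\<lambda>i. norm (x n i)) ` {..<n}) / sqrt (real n)"
        using that by (intro divide_right_mono Max_ge) auto
      finally show ?thesis
        unfolding b_def by (simp add: mult_left_mono)
    qed
    have "(\<lambda>n. s n \<bullet> r n + d) \<longlonglongrightarrow> s0 \<bullet> (Sigma0 *v beta0) + d"
      by (intro tendsto_intros s r)
    from triangular_array_cos_tendsto[OF prob indep int1 int2 int4 mean0 var1 mom4 sq b b0 this]
    have "(\<lambda>n. \<integral>\<omega>. cos (t \<bullet> X n \<omega> + d) \<partial>Ms n)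
        \<longlonglongrightarrow> exp (- (s0 \<bullet> (Sigma0 *v s0)) / 2) * cos (s0 \<bullet> (Sigma0 *v beta0) + d)"
      unfolding tX .
    \<comment> \<open>The limit is recognised as a cosine integral of the normal law in direction
      \<open>s0\<close>; moving \<open>matrix_inv A0\<close> back from \<open>t\<close> then yields
      \<open>L\<close>.\<close>
    also have "exp (- (s0 \<bullet> (Sigma0 *v s0)) / 2) * cos (s0 \<bullet> (Sigma0 *v beta0) + d)
        = (\<integral>z. cos (s0 \<bullet> z + (s0 \<bullet> (Sigma0 *v beta0) + d)) \<partial>mvnormal0 Sigma0)"
      by (rule mvnormal0_cos[OF Sigma0_pd, symmetric])
    also have "\<dots> = (\<integral>y. cos (t \<bullet> y + d) \<partial>L)"
      unfolding L_def
      by (subst integral_distr)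
        (simp_all add: inner_matrix_inv_pos_def[OF A(2)] s0_def inner_add_right add_ac)
    finally show "(\<lambda>n. \<integral>\<omega>. cos (t \<bullet> X n \<omega> + d) \<partial>Ms n) \<longlonglongrightarrow> (\<integral>y. cos (t \<bullet> y + d) \<partial>L)" .
  next
    show "\<forall>\<^sub>F n in sequentially. integrable (Ms n) (\<lambda>\<omega>. (norm (X n \<omega>))\<^sup>2) \<and>
        (\<integral>\<omega>. (norm (X n \<omega>))\<^sup>2 \<partial>Ms n) \<le> 2 / c\<^sup>2 * (R\<^sup>2 + real CARD('k))"
      using scaled eventually_gt_at_top[of 0]
    proof eventually_elim
      case (elim n)
      interpret prob_space "Ms n" by (rule prob)
      define W where "W \<omega> = (\<Sum>i<n. eps n i \<omega> *\<^sub>R u n i)" for \<omega>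
      have intW: "integrable (Ms n) (\<lambda>\<omega>. (norm (W \<omega>))\<^sup>2)"
        unfolding W_def by (intro integrable_norm2_weighted_sum indep int1 int2 mean0 var1)
      \<comment> \<open>Summed over \<open>i\<close>, each coordinate contributes exactly 1 by
        \<open>scaled\<close>, so the second moment of \<open>W\<close> is the dimension for every
        such \<open>n\<close>.\<close>
      have "(norm (u n i))\<^sup>2 = (\<Sum>k\<in>UNIV. (x n i $ k)\<^sup>2 / real n)" for i
        by (simp add: u_def power_mult_distrib power_divide norm_vec_def L2_set_def sum_nonneg sum_divide_distrib)
      then have "(\<Sum>i<n. (norm (u n i))\<^sup>2) = (\<Sum>k\<in>UNIV. \<Sum>i<n. (x n i $ k)\<^sup>2 / real n)"
        by (simp only: sum.swap[of _ UNIV])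
      also have "\<dots> = real CARD('k)"
        using elim by (simp add: sum_divide_distrib[symmetric])
      finally have EW: "(\<integral>\<omega>. (norm (W \<omega>))\<^sup>2 \<partial>Ms n) = real CARD('k)"
        unfolding W_def by (subst expectation_norm2_weighted_sum[OF indep int1 int2 mean0 var1])
      \<comment> \<open>Uniform coercivity of \<open>A n\<close> bounds \<open>X n\<close> by
        \<open>r n + W\<close>, so one constant serves for all large \<open>n\<close>.\<close>
      have bound: "(norm (X n \<omega>))\<^sup>2 \<le> 2 / c\<^sup>2 * (R\<^sup>2 + (norm (W \<omega>))\<^sup>2)" for \<omega>
      proof -
        have "A n *v X n \<omega> = r n + W \<omega>"
          unfolding X_def W_def
          by (simp only: matrix_vector_mul_assoc pos_def_mat_inverse[OF A(3)] matrix_vector_mul_lid)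
        then have "c * norm (X n \<omega>) \<le> norm (r n + W \<omega>)"
          using coercive_norm_le[OF c(2)[of "X n \<omega>" n]] by simp
        also have "\<dots> \<le> R + norm (W \<omega>)"
          using norm_triangle_ineq[of "r n" "W \<omega>"] R[of n] by simp
        finally have "(c * norm (X n \<omega>))\<^sup>2 \<le> (R + norm (W \<omega>))\<^sup>2"
          using c(1) by (intro power_mono) auto
        also have "\<dots> \<le> 2 * (R\<^sup>2 + (norm (W \<omega>))\<^sup>2)"
          using sum_squares_bound[of R "norm (W \<omega>)"] by (simp add: power2_sum)
        finally show ?thesis
          using c(1) by (simp add: power_mult_distrib field_simps)
      qed
      have intB: "integrable (Ms n) (\<lambda>\<omega>. 2 / c\<^sup>2 * (R\<^sup>2 + (norm (W \<omega>))\<^sup>2))"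
        using intW by simp
      have intX: "integrable (Ms n) (\<lambda>\<omega>. (norm (X n \<omega>))\<^sup>2)"
        by (rule Bochner_Integration.integrable_bound[OF intB])
          (use X_meas bound in \<open>auto intro: order_trans[OF bound abs_ge_self]\<close>)
      have "(\<integral>\<omega>. (norm (X n \<omega>))\<^sup>2 \<partial>Ms n) \<le> (\<integral>\<omega>. 2 / c\<^sup>2 * (R\<^sup>2 + (norm (W \<omega>))\<^sup>2) \<partial>Ms n)"
        by (intro integral_mono intX intB bound)
      also have "\<dots> = 2 / c\<^sup>2 * (R\<^sup>2 + real CARD('k))"
        using intW EW prob_space by simp
      finally show ?case
        using intX by simp
    qed
  qed (simp_all add: prob X_meas L_def)
  have eq: "\<forall>\<^sub>F n in sequentially. (\<integral>\<omega>. f (X n \<omega>) \<partial>Ms n) =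
      (\<integral>\<omega>. f (posterior_mean n (x n)
        (\<lambda>i. sqrt (real n) * ((x n i \<bullet> beta0) / sqrt (real n) + eps n i \<omega>)) gamma0) \<partial>Ms n)"
    for f :: "real^'k \<Rightarrow> real"
    using eventually_gt_at_top[of 0]
  proof eventually_elim
    case (elim n)
    show ?case
      unfolding posterior_mean_gaussian_data[OF g elim] X_def A_def r_def S_def u_def ..
  qed
  show ?thesis
    unfolding conv_in_distr_def A0_def[symmetric] L_def[symmetric]
  proof (intro allI impI)
    fix f :: "real^'k \<Rightarrow> real" assume "continuous_on UNIV f \<and> bounded (range f)"
    then have "(\<lambda>n. \<integral>\<omega>. f (X n \<omega>) \<partial>Ms n) \<longlonglongrightarrow> (\<integral>y. f y \<partial>L)"
      using conv unfolding conv_in_distr_def by blast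
    then show "(\<lambda>n. \<integral>\<omega>. f (posterior_mean n (x n)
        (\<lambda>i. sqrt (real n) * ((x n i \<bullet> beta0) / sqrt (real n) + eps n i \<omega>)) gamma0) \<partial>Ms n)
        \<longlonglongrightarrow> (\<integral>y. f y \<partial>L)"
      by (rule Lim_transform_eventually) (rule eq)
  qed
qed

end
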